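(* Let $\mathcal{P}$ be a smooth additive hypergraph property with $d(\mathcal{P})=r\ge 1$, let $k\ge 2$, and let $\delta=kr\ge 3$. Let $L$ be a list-assignment for a hypergraph $H$ with $|L(v)|=k$ for all $v\in V(H)$, and let $H\ne K_{\delta+1}$ be locally linear with respect to $(\mathcal{P},L)$. Then $$d(H)\ge a(\delta,|H|),\qquad\text{where } a(\delta,n)=\delta n+\frac{\delta-2}{\delta^2+2\delta-2}\,n .$$
   Context: A hypergraph is a triple $H=(V,E,i)$ with $V,E$ finite and $i:E\to 2^V$, $|i(e)|\ge 2$ (parallel edges allowed); $|H|=|V(H)|$. It is simple if no two distinct edges have the same vertex set. For $X\subseteq V(H)$, $H[X]$ is the induced subhypergraph on $X$ (edges $e$ with $i(e)\subseteq X$), $H-v=H[V(H)\setminus\{v\}]$, and the shrinking $H(X)$ has vertex set $X$, edges $\{e:|i(e)\cap X|\ge2\}$ and incidence $e\mapsto i(e)\cap X$. $d_H(v)$ is the number of edges containing $v$, $\delta(H)$ the minimum degree, and $d(H)=\sum_{v\in V(H)}d_H(v)$. $K_{n}$ is the complete simple graph on $n$ vertices. A hypergraph property is an isomorphism-closed class of hypergraphs; it is smooth if closed under induced subhypergraphs and it contains a non-empty hypergraph but not all hypergraphs; it is additive if closed under vertex-disjoint unions. $\mathcal{F}(\mathcal{P})$ is the class of $H\notin\mathcal{P}$ with $H-v\in\mathcal{P}$ for all $v$, and $d(\mathcal{P})=\min\{\delta(H):H\in\mathcal{F}(\mathcal{P})\}$. For a list-assignment $L:V(H)\to 2^C$,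 a $(\mathcal{P},L)$-coloring is $\varphi:V(H)\to C$ with $\varphi(v)\in L(v)$ and $H[\varphi^{-1}(c)]\in\mathcal{P}$ for all $c$; $H$ is $(\mathcal{P},L)$-critical if it has no $(\mathcal{P},L)$-coloring while every $H-v$ has one. With $r=d(\mathcal{P})$, $V(H,\mathcal{P},L)=\{v: d_H(v)=r|L(v)|\}$. $H$ is locally linear with respect to $(\mathcal{P},L)$ if $H$ is $(\mathcal{P},L)$-critical and the hypergraph $H(V(H,\mathcal{P},L))$ is simple. *)

theory Defs
  imports Complex_Main "HOL-Library.Infinite_Typeclass"
begin

record ('v, 'e) hypergraph =
  vert_set :: "'v set"
  edge_set :: "'e set"
  inc :: "'e \<Rightarrow> 'v set"

text \<open>The incidence function is total in HOL; its values outside \<open>edge_set\<close> are irrelevant.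
  Parallel edges are allowed, the empty hypergraph is a hypergraph.\<close>

definition is_hypergraph :: "('v, 'e) hypergraph \<Rightarrow> bool" where
  "is_hypergraph H \<longleftrightarrow> finite (vert_set H) \<and> finite (edge_set H) \<and>
     (\<forall>e\<in>edge_set H. inc H e \<subseteq> vert_set H \<and> 2 \<le> card (inc H e))"

definition hiso :: "('v, 'e) hypergraph \<Rightarrow> ('w, 'f) hypergraph \<Rightarrow> bool" where
  "hiso H H' \<longleftrightarrow> (\<exists>\<alpha> \<beta>. bij_betw \<alpha> (vert_set H) (vert_set H') \<and>
     bij_betw \<beta> (edge_set H) (edge_set H') \<and>
     (\<forall>e\<in>edge_set H. inc H' (\<beta> e) = \<alpha> ` inc H e))"

definition hsimple :: "('v, 'e) hypergraph \<Rightarrow> bool" where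
  "hsimple H \<longleftrightarrow> (\<forall>e\<in>edge_set H. \<forall>f\<in>edge_set H. e \<noteq> f \<longrightarrow> inc H e \<noteq> inc H f)"

definition induced_sub :: "('v, 'e) hypergraph \<Rightarrow> 'v set \<Rightarrow> ('v, 'e) hypergraph" where
  "induced_sub H X = \<lparr>vert_set = X, edge_set = {e \<in> edge_set H. inc H e \<subseteq> X}, inc = inc H\<rparr>"

definition del_vert :: "('v, 'e) hypergraph \<Rightarrow> 'v \<Rightarrow> ('v, 'e) hypergraph" where
  "del_vert H v = induced_sub H (vert_set H - {v})"

definition shrinking :: "('v, 'e) hypergraph \<Rightarrow> 'v set \<Rightarrow> ('v, 'e) hypergraph" where
  "shrinking H X = \<lparr>vert_set = X, edge_set = {e \<in> edge_set H. 2 \<le> card (inc H e \<inter> X)},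
     inc = (\<lambda>e. inc H e \<inter> X)\<rparr>"

definition hdeg :: "('v, 'e) hypergraph \<Rightarrow> 'v \<Rightarrow> nat" where
  "hdeg H v = card {e \<in> edge_set H. v \<in> inc H e}"

text \<open>Only meaningful for hypergraphs with at least one vertex.\<close>

definition min_hdeg :: "('v, 'e) hypergraph \<Rightarrow> nat" where
  "min_hdeg H = Min (hdeg H ` vert_set H)"

definition hdeg_sum :: "('v, 'e) hypergraph \<Rightarrow> nat" where
  "hdeg_sum H = (\<Sum>v\<in>vert_set H. hdeg H v)"

text \<open>\<open>H\<close> is (isomorphic to) \<open>K\<^sub>n\<close>: each two-element set of vertices is the vertex set of
  exactly one edge, and there are no other edges.\<close>

definition is_complete_graph :: "nat \<Rightarrow> ('v, 'e) hypergraph \<Rightarrow> bool" where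
  "is_complete_graph n H \<longleftrightarrow> is_hypergraph H \<and> card (vert_set H) = n \<and>
     bij_betw (inc H) (edge_set H) {X. X \<subseteq> vert_set H \<and> card X = 2}"

definition hunion :: "('v, 'e) hypergraph \<Rightarrow> ('v, 'e) hypergraph \<Rightarrow> ('v, 'e) hypergraph" where
  "hunion G H = \<lparr>vert_set = vert_set G \<union> vert_set H, edge_set = edge_set G \<union> edge_set H,
     inc = (\<lambda>e. if e \<in> edge_set G then inc G e else inc H e)\<rparr>"

text \<open>Properties are sets of hypergraphs over fixed ambient types. These types are required to be
  infinite, so that every finite hypergraph has an isomorphic copy there and disjoint copies
  always exist; an isomorphism-closed class of finite hypergraphs is then the same thing as an
  isomorphism-closed set of hypergraphs over these types.\<close>

definition hypergraph_property :: "('v::infinite, 'e::infinite) hypergraph set \<Rightarrow> bool" where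
  "hypergraph_property P \<longleftrightarrow> (\<forall>H\<in>P. is_hypergraph H) \<and>
     (\<forall>H H'. H \<in> P \<longrightarrow> is_hypergraph H' \<longrightarrow> hiso H H' \<longrightarrow> H' \<in> P)"

definition smooth_property :: "('v::infinite, 'e::infinite) hypergraph set \<Rightarrow> bool" where
  "smooth_property P \<longleftrightarrow> (\<forall>H\<in>P. \<forall>X. X \<subseteq> vert_set H \<longrightarrow> induced_sub H X \<in> P) \<and>
     (\<exists>H\<in>P. vert_set H \<noteq> {}) \<and> (\<exists>H. is_hypergraph H \<and> H \<notin> P)"

definition additive_property :: "('v::infinite, 'e::infinite) hypergraph set \<Rightarrow> bool" where
  "additive_property P \<longleftrightarrow> (\<forall>G\<in>P. \<forall>H\<in>P. vert_set G \<inter> vert_set H = {} \<longrightarrow>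
     edge_set G \<inter> edge_set H = {} \<longrightarrow> hunion G H \<in> P)"

definition min_forbidden ::
    "('v::infinite, 'e::infinite) hypergraph set \<Rightarrow> ('v, 'e) hypergraph set" where
  "min_forbidden P = {H. is_hypergraph H \<and> H \<notin> P \<and> (\<forall>v\<in>vert_set H. del_vert H v \<in> P)}"

text \<open>For smooth properties the set of values is non-empty (and each of the hypergraphs involved
  has a vertex), so the infimum in \<open>nat\<close> is a minimum.\<close>

definition prop_deg :: "('v::infinite, 'e::infinite) hypergraph set \<Rightarrow> nat" where
  "prop_deg P = (INF H\<in>min_forbidden P. min_hdeg H)"

definition is_coloring ::
    "('v::infinite, 'e::infinite) hypergraph set \<Rightarrow> ('v \<Rightarrow> 'c set) \<Rightarrow> ('v, 'e) hypergraph \<Rightarrow>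
      ('v \<Rightarrow> 'c) \<Rightarrow> bool" where
  "is_coloring P L H \<phi> \<longleftrightarrow> (\<forall>v\<in>vert_set H. \<phi> v \<in> L v) \<and>
     (\<forall>c. induced_sub H {v \<in> vert_set H. \<phi> v = c} \<in> P)"

definition list_critical ::
    "('v::infinite, 'e::infinite) hypergraph set \<Rightarrow> ('v \<Rightarrow> 'c set) \<Rightarrow> ('v, 'e) hypergraph \<Rightarrow> bool"
  where
  "list_critical P L H \<longleftrightarrow> (\<nexists>\<phi>. is_coloring P L H \<phi>) \<and>
     (\<forall>v\<in>vert_set H. \<exists>\<phi>. is_coloring P L (del_vert H v) \<phi>)"

definition low_verts ::
    "('v::infinite, 'e::infinite) hypergraph set \<Rightarrow> ('v \<Rightarrow> 'c set) \<Rightarrow> ('v, 'e) hypergraph \<Rightarrow> 'v set"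
  where
  "low_verts P L H = {v \<in> vert_set H. hdeg H v = prop_deg P * card (L v)}"

definition locally_linear ::
    "('v::infinite, 'e::infinite) hypergraph set \<Rightarrow> ('v \<Rightarrow> 'c set) \<Rightarrow> ('v, 'e) hypergraph \<Rightarrow> bool"
  where
  "locally_linear P L H \<longleftrightarrow> list_critical P L H \<and> hsimple (shrinking H (low_verts P L H))"

definition gallai_bound :: "nat \<Rightarrow> nat \<Rightarrow> real" where
  "gallai_bound \<delta> n = real \<delta> * real n +
     (real \<delta> - 2) / ((real \<delta>)\<^sup>2 + 2 * real \<delta> - 2) * real n"

end

theory Submission imports Defs
begin

text \<open>
  Call a vertex \<open>v\<close> low if \<open>d(v) = \<delta>\<close>. Given a coloring \<open>\<phi>\<close> of \<open>H - v\<close> with \<open>v\<close> low, counting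
  degrees in minimal forbidden subhypergraphs shows that every edge at \<open>v\<close> is monochromatic apart
  from \<open>v\<close>, that every color of \<open>L(v)\<close> occurs on exactly \<open>r\<close> of these edges, and that the hole may
  be moved: a neighbor \<open>u\<close> of \<open>v\<close> can hand its color to \<open>v\<close> and become the uncolored vertex.
  Sliding the hole around as in the 15-puzzle within a 2-connected set \<open>X\<close> of low vertices such
  that every other edge meets \<open>X\<close> at most once forces \<open>X\<close> to have maximum degree at most \<open>r\<close>,
  or to be a complete graph or a cycle. A complete graph on \<open>\<delta> + 1\<close> low vertices would be all of \<open>H\<close>, so
  Gallai's induction over cut vertices yields average degree at most \<open>\<delta> - 1 + 2/\<delta>\<close> in the
  hypergraph of low vertices. Hence at least \<open>(1 - 2/\<delta>)|U|\<close> edges meet the set \<open>U\<close> of low vertices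
  in a single vertex, and so contain other vertices; combined with the lower bound \<open>\<delta> + 1\<close> for
  the degrees of the latter this is the assertion.
\<close>

section \<open>Sliding a hole through a 2-connected graph\<close>

text \<open>The bound \<open>r\<close> is a color multiplicity: if the neighbors of \<open>v\<close>
  inside \<open>X\<close> always show one color (\<open>good\<close>), all edges at \<open>v\<close>
  inside \<open>X\<close> belong to a single color, which occurs only \<open>r\<close> times.
  Goodness spreads along adjacency, so one good vertex suffices. An edge with three low vertices in
  \<open>X\<close> provides one; otherwise \<open>X\<close> is a simple graph with a counting
  invariant: the number of neighbors in \<open>X\<close> of a given color is fixed by the colors
  outside \<open>X\<close>. Two obstacles shape the rest. Low vertices see only the trace of
  \<open>H\<close>, so the edges of a clique of low vertices might contain hidden high vertices;
  sliding has to exclude this before additivity applies. And a bound on the average degree is not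
  inductive across a cut vertex. The induction therefore carries a root and a charge
  \<open>c - 2\<close> for each pendant vertex, where \<open>c = \<delta> - 1 + 2 / \<delta>\<close>
  solves \<open>(\<delta> - 1) * (\<delta> - c) = c - 2\<close>: the surplus of a complete graph on
  \<open>\<delta>\<close> vertices is exactly the charge of the pendant vertex at which it
  hangs.\<close>

definition connected_in :: "('v \<Rightarrow> 'v \<Rightarrow> bool) \<Rightarrow> 'v set \<Rightarrow> bool" where
  "connected_in adj X \<longleftrightarrow>
     (\<forall>A. A \<subseteq> X \<longrightarrow> A \<noteq> {} \<longrightarrow> A \<noteq> X \<longrightarrow> (\<exists>a\<in>A. \<exists>b\<in>X - A. adj a b))"

definition biconnected :: "('v \<Rightarrow> 'v \<Rightarrow> bool) \<Rightarrow> 'v set \<Rightarrow> bool" where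
  "biconnected adj X \<longleftrightarrow> connected_in adj X \<and> (\<forall>y\<in>X. connected_in adj (X - {y}))"

lemma connected_inD:
  assumes "connected_in adj X" "A \<subseteq> X" "a \<in> A" "b \<in> X" "b \<notin> A"
  obtains u v where "u \<in> A" "v \<in> X" "v \<notin> A" "adj u v"
  using assms unfolding connected_in_def by (metis Diff_iff empty_iff)

locale sliding =
  fixes adj :: "'v \<Rightarrow> 'v \<Rightarrow> bool" and St :: "'v \<Rightarrow> ('v \<Rightarrow> 'c) \<Rightarrow> bool" and X :: "'v set"
  assumes adj_sym: "adj u v \<Longrightarrow> adj v u"
    and adj_irrefl: "\<not> adj v v"
    and slide: "St v \<phi> \<Longrightarrow> v \<in> X \<Longrightarrow> u \<in> X \<Longrightarrow> adj v u \<Longrightarrow> St u (\<phi>(v := \<phi> u))"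
    and biconn: "biconnected adj X"
begin

text \<open>\<open>St v \<phi>\<close> says that \<open>\<phi>\<close> is an admissible arrangement of colors with the hole at \<open>v\<close>; the value
  \<open>\<phi> v\<close> is junk.\<close>

definition good :: "'v \<Rightarrow> bool" where
  "good v \<longleftrightarrow> (\<forall>\<phi>. St v \<phi> \<longrightarrow> (\<forall>u\<in>X. \<forall>u'\<in>X. adj v u \<longrightarrow> adj v u' \<longrightarrow> \<phi> u = \<phi> u'))"

lemma goodI:
  assumes "\<And>\<phi> u. St v \<phi> \<Longrightarrow> u \<in> X \<Longrightarrow> adj v u \<Longrightarrow> \<phi> u = g \<phi>"
  shows "good v"
  unfolding good_def
proof (intro allI impI ballI)
  fix \<phi> u u' assume "St v \<phi>" "u \<in> X" "u' \<in> X" "adj v u" "adj v u'"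
  then show "\<phi> u = \<phi> u'" using assms[of \<phi> u] assms[of \<phi> u'] by simp
qed

lemma conn: "connected_in adj X"
  using biconn by (simp add: biconnected_def)

lemma conn_minus: "z \<in> X \<Longrightarrow> connected_in adj (X - {z})"
  using biconn by (simp add: biconnected_def)

text \<open>As \<open>X - {z}\<close> is connected, the vertices outside \<open>W\<close> that the
  hole can reach from \<open>y\<close> must have a neighbor in \<open>W\<close>; stopping there
  leaves the colors on \<open>W\<close> and at \<open>z\<close> untouched. The exit \<open>t\<close>
  and entry \<open>w\<close> are chosen before the arrangement, and the ear argument depends on this
  uniformity.\<close>

lemma travel:
  assumes z: "z \<in> X" and W: "W \<subseteq> X - {z}" "W \<noteq> {}" and y: "y \<in> X - {z} - W"
  obtains t w where "t \<in> X - {z} - W" "w \<in> W" "adj t w"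
    "\<And>\<phi>. St y \<phi> \<Longrightarrow> \<exists>\<phi>'. St t \<phi>' \<and> (\<forall>u. u \<notin> X - {z} - W \<longrightarrow> \<phi>' u = \<phi> u)"
proof -
  define R where "R = {t \<in> X - {z} - W.
    \<forall>\<phi>. St y \<phi> \<longrightarrow> (\<exists>\<phi>'. St t \<phi>' \<and> (\<forall>u. u \<notin> X - {z} - W \<longrightarrow> \<phi>' u = \<phi> u))}"
  have yR: "y \<in> R" using y by (auto simp: R_def)
  obtain w0 where w0: "w0 \<in> W" using W by blast
  have "R \<subseteq> X - {z}" "w0 \<in> X - {z}" "w0 \<notin> R" using W w0 by (auto simp: R_def)
  then obtain a b where ab: "a \<in> R" "b \<in> X - {z}" "b \<notin> R" "adj a b"
    using connected_inD[OF conn_minus[OF z] _ yR] by metis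
  have "b \<in> W"
  proof (rule ccontr)
    assume bW: "b \<notin> W"
    have "\<exists>\<phi>'. St b \<phi>' \<and> (\<forall>u. u \<notin> X - {z} - W \<longrightarrow> \<phi>' u = \<phi> u)" if s: "St y \<phi>" for \<phi>
    proof -
      obtain \<phi>' where p: "St a \<phi>'" "\<forall>u. u \<notin> X - {z} - W \<longrightarrow> \<phi>' u = \<phi> u"
        using ab(1) s by (auto simp: R_def)
      have "St b (\<phi>'(a := \<phi>' b))"
        using slide[OF p(1)] ab by (auto simp: R_def)
      moreover have "\<forall>u. u \<notin> X - {z} - W \<longrightarrow> (\<phi>'(a := \<phi>' b)) u = \<phi> u"
        using p(2) ab(1) by (auto simp: R_def)
      ultimately show ?thesis by blast
    qed
    then have "b \<in> R" using ab bW by (auto simp: R_def)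
    then show False using ab by simp
  qed
  then show ?thesis using that[of a b] ab by (auto simp: R_def)
qed

text \<open>The hole at \<open>z\<close> steps to \<open>y\<close>, leaving the color of
  \<open>y\<close> on \<open>z\<close>, travels around \<open>z\<close> to a neighbor
  \<open>t\<close> of \<open>v\<close>, and enters \<open>v\<close>, leaving the old color of
  \<open>v\<close> on \<open>t\<close>. Goodness at \<open>v\<close> then compares \<open>z\<close>
  with \<open>t\<close>.\<close>

lemma good_step:
  assumes v: "good v" "v \<in> X" and z: "z \<in> X" and vz: "adj v z"
  shows "good z"
proof -
  have *: "\<phi> y = \<phi> v" if st: "St z \<phi>" and y: "y \<in> X" "adj z y" for \<phi> y
  proof (cases "y = v")
    case False
    have nz: "y \<noteq> z" "v \<noteq> z" using y vz adj_irrefl by auto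
    have W: "{v} \<subseteq> X - {z}" "{v} \<noteq> {}" "y \<in> X - {z} - {v}" using v nz y False by auto
    obtain t w where t: "t \<in> X - {z} - {v}" "w \<in> {v}" "adj t w"
      and tr: "\<And>\<phi>. St y \<phi> \<Longrightarrow> \<exists>\<phi>'. St t \<phi>' \<and> (\<forall>u. u \<notin> X - {z} - {v} \<longrightarrow> \<phi>' u = \<phi> u)"
      using travel[OF z W] by metis
    obtain \<phi>' where p: "St t \<phi>'" "\<forall>u. u \<notin> X - {z} - {v} \<longrightarrow> \<phi>' u = (\<phi>(z := \<phi> y)) u"
      using tr[OF slide[OF st z y]] by blast
    have "St v (\<phi>'(t := \<phi>' v))" using slide[OF p(1), of v] t v by auto
    moreover have "adj v t" using t adj_sym by auto
    ultimately have "(\<phi>'(t := \<phi>' v)) z = (\<phi>'(t := \<phi>' v)) t"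
      using v(1) z t vz unfolding good_def by (metis DiffD1)
    then show ?thesis using t p(2) nz by auto
  qed auto
  show ?thesis using * by (rule goodI)
qed

lemma good_all:
  assumes "good v" "v \<in> X" "z \<in> X"
  shows "good z"
proof (rule ccontr)
  assume "\<not> good z"
  then obtain a b where "a \<in> {u \<in> X. good u}" "b \<in> X" "b \<notin> {u \<in> X. good u}" "adj a b"
    using connected_inD[OF conn, of "{u \<in> X. good u}" v z] assms by auto
  then show False using good_step by blast
qed

text \<open>The hole leaves \<open>e\<close> through an outside neighbor \<open>x\<close> of
  \<open>v\<close> and returns at another vertex \<open>w\<close> of \<open>e\<close>. Now
  \<open>v\<close> carries the color of \<open>x\<close>, while a third vertex of \<open>e\<close>
  keeps its old color, and \<open>mono\<close> at \<open>w\<close> compares the two.\<close>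

lemma large_edge_good:
  assumes e: "e \<subseteq> X" "v \<in> e" "a \<in> e" "b \<in> e" "a \<noteq> v" "b \<noteq> v" "a \<noteq> b"
    and mono: "\<And>u \<phi> x y. u \<in> e \<Longrightarrow> St u \<phi> \<Longrightarrow> x \<in> e - {u} \<Longrightarrow> y \<in> e - {u} \<Longrightarrow> \<phi> x = \<phi> y"
  shows "good v"
proof -
  have *: "\<phi> x = \<phi> a" if st: "St v \<phi>" and x: "x \<in> X" "adj v x" for \<phi> x
  proof (cases "x \<in> e")
    case True
    then show ?thesis using mono[OF e(2) st, of x a] x adj_irrefl e by auto
  next
    case False
    have vX: "v \<in> X" using e by auto
    have W: "e - {v} \<subseteq> X - {v}" "e - {v} \<noteq> {}" "x \<in> X - {v} - (e - {v})"
      using e x False by auto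
    obtain t w where t: "t \<in> X - {v} - (e - {v})" "w \<in> e - {v}" "adj t w"
      and tr: "\<And>\<phi>. St x \<phi> \<Longrightarrow> \<exists>\<phi>'. St t \<phi>' \<and> (\<forall>u. u \<notin> X - {v} - (e - {v}) \<longrightarrow> \<phi>' u = \<phi> u)"
      using travel[OF vX W] by metis
    obtain \<phi>' where p: "St t \<phi>'"
        "\<forall>u. u \<notin> X - {v} - (e - {v}) \<longrightarrow> \<phi>' u = (\<phi>(v := \<phi> x)) u"
      using tr[OF slide[OF st vX x]] by blast
    have s: "St w (\<phi>'(t := \<phi>' w))" using slide[OF p(1), of w] t e by auto
    obtain z where z: "z \<in> e" "z \<noteq> v" "z \<noteq> w" using e by metis
    have "(\<phi>'(t := \<phi>' w)) v = (\<phi>'(t := \<phi>' w)) z"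
      using mono[OF _ s, of v z] t z e by auto
    moreover have "z \<noteq> t" "v \<noteq> t" using z t e by auto
    ultimately have "\<phi> x = \<phi> z" using p(2) z e by auto
    then show ?thesis using mono[OF e(2) st, of z a] z e by auto
  qed
  show ?thesis using * by (rule goodI)
qed

text \<open>A cycle of length \<open>n\<close> is a sequence of period \<open>n\<close>, so that rotating it is shifting the index.\<close>

definition cyc :: "nat \<Rightarrow> (nat \<Rightarrow> 'v) \<Rightarrow> bool" where
  "cyc n c \<longleftrightarrow> 4 \<le> n \<and> (\<forall>i. c (i + n) = c i) \<and> inj_on c {..<n} \<and>
     (\<forall>i. c i \<in> X \<and> adj (c i) (c (Suc i)))"

text \<open>Only chords at \<open>c 0\<close> are excluded; full chordlessness is stated through
  shifted sequences. A 4-cycle with one diagonal thus still qualifies when it starts off that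
  diagonal.\<close>

definition no_chord :: "nat \<Rightarrow> (nat \<Rightarrow> 'v) \<Rightarrow> bool" where
  "no_chord n c \<longleftrightarrow> (\<forall>j<n. adj (c 0) (c j) \<longrightarrow> j = 1 \<or> j = n - 1)"

section \<open>Cycles and the rotation of the hole around them\<close>

lemma cyc_mod: "cyc n c \<Longrightarrow> c i = c (i mod n)"
proof (induction i rule: less_induct)
  case (less i)
  show ?case
  proof (cases "i < n")
    case False
    then have "c i = c (i - n)" using less.prems by (metis cyc_def le_add_diff_inverse2 not_less)
    also have "\<dots> = c ((i - n) mod n)"
      using less False by (simp add: cyc_def)
    finally show ?thesis using False by (simp add: le_mod_geq)
  qed simp
qed

lemma cyc_eq_iff: "cyc n c \<Longrightarrow> c i = c j \<longleftrightarrow> i mod n = j mod n"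
proof -
  assume c: "cyc n c"
  then have "n > 0" by (simp add: cyc_def)
  then have "i mod n \<in> {..<n}" "j mod n \<in> {..<n}" by auto
  moreover have "inj_on c {..<n}" using c by (simp add: cyc_def)
  ultimately show ?thesis using cyc_mod[OF c] by (metis inj_onD)
qed

lemma cyc_neq: "cyc n c \<Longrightarrow> i < n \<Longrightarrow> j < n \<Longrightarrow> i \<noteq> j \<Longrightarrow> c i \<noteq> c j"
  by (simp add: cyc_eq_iff)

lemma cyc_last_adj:
  assumes "cyc n c"
  shows "adj (c (n - 1)) (c 0)"
proof -
  have "adj (c (n - 1)) (c (Suc (n - 1)))" using assms unfolding cyc_def by blast
  moreover have "Suc (n - 1) = n" using assms by (simp add: cyc_def)
  moreover have "c (0 + n) = c 0" using assms unfolding cyc_def by blast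
  then have "c n = c 0" by simp
  ultimately show ?thesis by metis
qed

lemma cyc_image: "cyc n c \<Longrightarrow> c i \<in> c ` {..<n}"
proof -
  assume c: "cyc n c"
  then have "i mod n < n" by (simp add: cyc_def)
  then show ?thesis using cyc_mod[OF c, of i] by auto
qed

lemma cyc_shift:
  assumes c: "cyc n c"
  shows "cyc n (\<lambda>i. c (k + i))"
proof -
  have "inj_on (\<lambda>i. c (k + i)) {..<n}"
  proof (rule inj_onI)
    fix i j assume ij: "i \<in> {..<n}" "j \<in> {..<n}" "c (k + i) = c (k + j)"
    then have "(k + i) mod n = (k + j) mod n" using cyc_eq_iff[OF c] by simp
    then have "i mod n = j mod n" unfolding nat_mod_eq_iff by (simp add: add.assoc)
    then show "i = j" using ij by simp
  qed
  then show ?thesis using c by (simp add: cyc_def flip: add.assoc)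
qed

lemma cyc_walk:
  assumes c: "cyc n c" and st: "St (c 0) \<phi>" and k: "k < n"
  shows "\<exists>\<phi>'. St (c k) \<phi>' \<and> (\<forall>i<k. \<phi>' (c i) = \<phi> (c (Suc i))) \<and> (\<forall>u. u \<notin> c ` {..<k} \<longrightarrow> \<phi>' u = \<phi> u)"
  using k
proof (induction k)
  case 0
  then show ?case using st by auto
next
  case (Suc k)
  then obtain \<phi>' where p: "St (c k) \<phi>'" "\<forall>i<k. \<phi>' (c i) = \<phi> (c (Suc i))"
    "\<forall>u. u \<notin> c ` {..<k} \<longrightarrow> \<phi>' u = \<phi> u" by auto
  have inj: "c i \<noteq> c j" if "i < n" "j < n" "i \<noteq> j" for i j
    using cyc_neq[OF c] that by blast
  have "St (c (Suc k)) (\<phi>'(c k := \<phi>' (c (Suc k))))"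
    using slide[OF p(1)] c by (auto simp: cyc_def)
  moreover have "c (Suc k) \<notin> c ` {..<k}"
  proof
    assume "c (Suc k) \<in> c ` {..<k}"
    then obtain i where "i < k" "c (Suc k) = c i" by auto
    then show False using inj[of "Suc k" i] Suc.prems by simp
  qed
  then have "\<phi>' (c (Suc k)) = \<phi> (c (Suc k))" using p(3) by blast
  then have "\<forall>i<Suc k. (\<phi>'(c k := \<phi>' (c (Suc k)))) (c i) = \<phi> (c (Suc i))"
    using p(2) inj[of _ k] Suc.prems by (auto simp: less_Suc_eq)
  moreover have "\<forall>u. u \<notin> c ` {..<Suc k} \<longrightarrow> (\<phi>'(c k := \<phi>' (c (Suc k)))) u = \<phi> u"
    using p(3) by (auto simp: lessThan_Suc)
  ultimately show ?case by blast
qed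

text \<open>A full turn has \<open>n\<close> steps, but besides the hole the cycle carries only
  \<open>n - 1\<close> colors; so they come back shifted by one place, with the color of
  \<open>c 1\<close> moving to \<open>c (n - 1)\<close>.\<close>

lemma cyc_rotate:
  assumes c: "cyc n c" and st: "St (c 0) \<phi>"
  obtains \<phi>' where "St (c 0) \<phi>'" "\<And>i. 1 \<le> i \<Longrightarrow> i < n - 1 \<Longrightarrow> \<phi>' (c i) = \<phi> (c (Suc i))"
    "\<phi>' (c (n - 1)) = \<phi> (c 1)" "\<And>u. u \<notin> c ` {..<n} \<Longrightarrow> \<phi>' u = \<phi> u"
proof -
  have n: "4 \<le> n" using c by (simp add: cyc_def)
  have inj: "c i \<noteq> c j" if "i < n" "j < n" "i \<noteq> j" for i j
    using cyc_neq[OF c] that by blast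
  obtain \<phi>' where p: "St (c (n - 1)) \<phi>'" "\<forall>i<n - 1. \<phi>' (c i) = \<phi> (c (Suc i))"
    "\<forall>u. u \<notin> c ` {..<n - 1} \<longrightarrow> \<phi>' u = \<phi> u" using cyc_walk[OF c st, of "n - 1"] n by auto
  have "adj (c (n - 1)) (c 0)" by (rule cyc_last_adj[OF c])
  then have "St (c 0) (\<phi>'(c (n - 1) := \<phi>' (c 0)))"
    using slide[OF p(1)] c by (auto simp: cyc_def)
  moreover have "(\<phi>'(c (n - 1) := \<phi>' (c 0))) (c i) = \<phi> (c (Suc i))"
    if "1 \<le> i" "i < n - 1" for i using p(2) inj[of i "n - 1"] that by auto
  moreover have "(\<phi>'(c (n - 1) := \<phi>' (c 0))) (c (n - 1)) = \<phi> (c 1)"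
    using p(2) n by auto
  moreover have "(\<phi>'(c (n - 1) := \<phi>' (c 0))) u = \<phi> u" if u: "u \<notin> c ` {..<n}" for u
  proof -
    have "u \<notin> c ` {..<n - 1}" "u \<noteq> c (n - 1)" using u n by auto
    then show ?thesis using p(3) by simp
  qed
  ultimately show ?thesis using that by blast
qed

end

section \<open>Color counts on chordless cycles of a graph\<close>

locale graph_sliding = sliding +
  assumes fin: "finite X"
    and count: "St v \<phi> \<Longrightarrow> St v \<phi>' \<Longrightarrow> v \<in> X \<Longrightarrow> (\<And>u. u \<notin> X \<Longrightarrow> \<phi> u = \<phi>' u) \<Longrightarrow>
      card {u \<in> X. adj v u \<and> \<phi> u = x} = card {u \<in> X. adj v u \<and> \<phi>' u = x}"
begin

text \<open>Among the neighbors of \<open>c 0\<close>, a full turn affects only \<open>c 1\<close>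
  and \<open>c (n - 1)\<close>: their colors become the old colors of \<open>c 2\<close> and
  \<open>c 1\<close>. Since \<open>count\<close> fixes the multiplicity of each color, both pairs
  agree as multisets.\<close>

lemma cyc_last:
  assumes c: "cyc n c" and nc: "no_chord n c" and st: "St (c 0) \<phi>"
  shows "\<phi> (c (n - 1)) = \<phi> (c 2)"
proof -
  have n: "4 \<le> n" using c by (simp add: cyc_def)
  obtain \<phi>' where p: "St (c 0) \<phi>'" "\<And>i. 1 \<le> i \<Longrightarrow> i < n - 1 \<Longrightarrow> \<phi>' (c i) = \<phi> (c (Suc i))"
    "\<phi>' (c (n - 1)) = \<phi> (c 1)" "\<And>u. u \<notin> c ` {..<n} \<Longrightarrow> \<phi>' u = \<phi> u"
    using cyc_rotate[OF c st] by metis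
  have cX: "c i \<in> X" for i using c by (simp add: cyc_def)
  define x where "x = \<phi> (c 2)"
  define R where "R = {u \<in> X - c ` {..<n}. adj (c 0) u}"
  have adj1: "adj (c 0) (c 1)" using c by (auto simp: cyc_def)
  have adjn: "adj (c 0) (c (n - 1))" by (rule adj_sym[OF cyc_last_adj[OF c]])
  have nb: "{u \<in> X. adj (c 0) u} = R \<union> {c 1, c (n - 1)}"
    using nc adj1 adjn cX by (auto simp: R_def no_chord_def)
  have ne: "c 1 \<noteq> c (n - 1)" using cyc_neq[OF c] n by simp
  have notR: "c 1 \<notin> R" "c (n - 1) \<notin> R" using n by (auto simp: R_def)
  have finR: "finite R" using fin by (simp add: R_def)
  have split: "card {u \<in> X. adj (c 0) u \<and> \<psi> u = x} =
      card {u \<in> R. \<psi> u = x} + (if \<psi> (c 1) = x then 1 else 0) + (if \<psi> (c (n - 1)) = x then 1 else 0)"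
    for \<psi> :: "'a \<Rightarrow> 'b"
  proof -
    have "{u \<in> X. adj (c 0) u \<and> \<psi> u = x} = {u \<in> {u \<in> X. adj (c 0) u}. \<psi> u = x}" by auto
    also have "\<dots> = {u \<in> R. \<psi> u = x} \<union>
       ((if \<psi> (c 1) = x then {c 1} else {}) \<union> (if \<psi> (c (n - 1)) = x then {c (n - 1)} else {}))"
      unfolding nb by auto
    also have "card \<dots> = card {u \<in> R. \<psi> u = x} +
       card ((if \<psi> (c 1) = x then {c 1} else {}) \<union> (if \<psi> (c (n - 1)) = x then {c (n - 1)} else {}))"
      using finR notR by (intro card_Un_disjoint) auto
    also have "card ((if \<psi> (c 1) = x then {c 1} else {}) \<union> (if \<psi> (c (n - 1)) = x then {c (n - 1)} else {}))
      = (if \<psi> (c 1) = x then 1 else 0) + (if \<psi> (c (n - 1)) = x then 1 else 0)"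
      using ne by auto
    finally show ?thesis by simp
  qed
  have R: "{u \<in> R. \<phi> u = x} = {u \<in> R. \<phi>' u = x}" using p(4) by (auto simp: R_def)
  have eq: "card {u \<in> X. adj (c 0) u \<and> \<phi> u = x} = card {u \<in> X. adj (c 0) u \<and> \<phi>' u = x}"
  proof (rule count[OF st p(1) cX])
    fix u assume "u \<notin> X"
    then have "u \<notin> c ` {..<n}" using cX by auto
    then show "\<phi> u = \<phi>' u" using p(4) by simp
  qed
  have "\<phi>' (c 1) = x" using p(2)[of 1] n by (simp add: x_def numeral_2_eq_2)
  then have "card {u \<in> X. adj (c 0) u \<and> \<phi>' u = x} =
      card {u \<in> R. \<phi>' u = x} + 1 + (if \<phi> (c 1) = x then 1 else 0)"
    unfolding split p(3) by simp
  then have "(if \<phi> (c (n - 1)) = x then 1 else 0) = (1::nat)"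
    using split[of \<phi>] unfolding eq R by simp
  then have "\<phi> (c (n - 1)) = x" by (metis zero_neq_one)
  then show ?thesis by (simp add: x_def)
qed

text \<open>One turn carries the relation of \<open>cyc_last\<close> to the case
  \<open>i = 1\<close>, and every further turn raises the index by one.\<close>

lemma cyc_two_apart:
  assumes c: "cyc n c" and nc: "no_chord n c"
  shows "St (c 0) \<phi> \<Longrightarrow> 1 \<le> i \<Longrightarrow> i + 2 < n \<Longrightarrow> \<phi> (c i) = \<phi> (c (i + 2))"
proof (induction i arbitrary: \<phi>)
  case (Suc i)
  obtain \<phi>' where p: "St (c 0) \<phi>'" "\<And>i. 1 \<le> i \<Longrightarrow> i < n - 1 \<Longrightarrow> \<phi>' (c i) = \<phi> (c (Suc i))"
    "\<phi>' (c (n - 1)) = \<phi> (c 1)"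
    using cyc_rotate[OF c Suc.prems(1)] by metis
  show ?case
  proof (cases "i = 0")
    case True
    have "\<phi>' (c 2) = \<phi> (c 3)" using p(2)[of 2] True Suc.prems by (simp add: numeral_3_eq_3 numeral_2_eq_2)
    then show ?thesis using cyc_last[OF c nc p(1)] p(3) True by (simp add: numeral_3_eq_3)
  next
    case False
    have "\<phi>' (c i) = \<phi>' (c (i + 2))" using Suc.IH[OF p(1)] False Suc.prems by simp
    then show ?thesis using p(2)[of i] p(2)[of "i + 2"] False Suc.prems by simp
  qed
qed auto

text \<open>For \<open>n = 4\<close> the two relations make \<open>c 1\<close>, \<open>c 2\<close>,
  \<open>c 3\<close> monochromatic. A trip out through \<open>y\<close> and back to
  \<open>c 0\<close> puts the color of \<open>y\<close> on one of these three, so it is the same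
  color. The diagonal from \<open>c 1\<close> to \<open>c 3\<close> may be present, a case that
  \<open>ear_good\<close> does not cover.\<close>

lemma four_cycle_good:
  assumes c: "cyc 4 c" and nc: "no_chord 4 c"
  shows "good (c 0)"
proof -
  have cX: "c i \<in> X" for i using c by (simp add: cyc_def)
  have d: "c 0 \<noteq> c 1" "c 0 \<noteq> c 2" "c 0 \<noteq> c 3" "c 1 \<noteq> c 2" "c 1 \<noteq> c 3" "c 2 \<noteq> c 3"
    using cyc_neq[OF c] by simp_all
  have im: "c ` {..<4} = {c 0, c 1, c 2, c 3}"
    by (auto simp: numeral_eq_Suc lessThan_Suc)
  have "c (0 + 4) = c 0" using c unfolding cyc_def by blast
  then have c4: "c 4 = c 0" by simp
  have "adj (c i) (c (Suc i))" for i using c by (simp add: cyc_def)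
  from this[of 0] this[of 1] this[of 2] this[of 3]
  have a: "adj (c 0) (c 1)" "adj (c 1) (c 2)" "adj (c 2) (c 3)" "adj (c 3) (c 0)"
    using c4 by (simp_all add: numeral_eq_Suc)
  have mono: "\<psi> (c 1) = \<psi> (c 2)" "\<psi> (c 2) = \<psi> (c 3)" if "St (c 0) \<psi>" for \<psi>
    using cyc_last[OF c nc that] cyc_two_apart[OF c nc that, of 1] by (simp_all add: numeral_3_eq_3)
  have *: "\<phi> y = \<phi> (c 1)" if st: "St (c 0) \<phi>" and y: "y \<in> X" "adj (c 0) y" for \<phi> y
  proof (cases "y \<in> c ` {..<4}")
    case True
    have "\<not> adj (c 0) (c 2)" using nc[unfolded no_chord_def, rule_format, of 2] by auto
    then show ?thesis using True mono[OF st] im y adj_irrefl by auto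
  next
    case False
    have W: "{c 1, c 2, c 3} \<subseteq> X - {c 0}" "{c 1, c 2, c 3} \<noteq> {}" "y \<in> X - {c 0} - {c 1, c 2, c 3}"
      using False im cX y d by auto
    obtain t w where t: "t \<in> X - {c 0} - {c 1, c 2, c 3}" "w \<in> {c 1, c 2, c 3}" "adj t w"
      and tr: "\<And>\<phi>. St y \<phi> \<Longrightarrow>
        \<exists>\<phi>'. St t \<phi>' \<and> (\<forall>u. u \<notin> X - {c 0} - {c 1, c 2, c 3} \<longrightarrow> \<phi>' u = \<phi> u)"
      using travel[OF cX W] by metis
    obtain \<phi>' where p: "St t \<phi>'"
        "\<forall>u. u \<notin> X - {c 0} - {c 1, c 2, c 3} \<longrightarrow> \<phi>' u = (\<phi>(c 0 := \<phi> y)) u"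
      using tr[OF slide[OF st cX y]] by blast
    define \<psi> where "\<psi> = \<phi>'(t := \<phi>' w)"
    have s: "St w \<psi>" unfolding \<psi>_def using slide[OF p(1), of w] t cX by auto
    have v: "\<psi> (c 0) = \<phi> y" "\<psi> (c 1) = \<phi> (c 1)" "\<psi> (c 2) = \<phi> (c 1)" "\<psi> (c 3) = \<phi> (c 1)"
      using p(2) t d mono[OF st] by (auto simp: \<psi>_def)
    consider "w = c 1" | "w = c 2" | "w = c 3" using t by auto
    then show ?thesis
    proof cases
      case 1
      have "St (c 0) (\<psi>(c 1 := \<psi> (c 0)))" using slide[of "c 1" \<psi> "c 0"] s 1 a cX adj_sym by auto
      from mono[OF this] show ?thesis using v d by auto
    next
      case 2
      have "St (c 3) (\<psi>(c 2 := \<psi> (c 3)))" using slide[of "c 2" \<psi> "c 3"] s 2 a cX by auto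
      from slide[OF this, of "c 0"] have "St (c 0) (\<psi>(c 2 := \<psi> (c 3), c 3 := \<psi> (c 0)))"
        using a cX d by auto
      from mono[OF this] show ?thesis using v d by auto
    next
      case 3
      have "St (c 0) (\<psi>(c 3 := \<psi> (c 0)))" using slide[of "c 3" \<psi> "c 0"] s 3 a cX by auto
      from mono[OF this] show ?thesis using v d by auto
    qed
  qed
  show ?thesis using * by (rule goodI)
qed

text \<open>The hole leaves the chordless cycle through the outside neighbor \<open>y\<close> and returns at some
  \<open>c j\<close>, which puts the color of \<open>y\<close> on \<open>c 0\<close>. As colors two apart on the cycle agree, \<open>y\<close> has the
  color of one of the neighbors of \<open>c 0\<close> on the cycle. Since \<open>j\<close> does not depend on the
  arrangement, rotating the cycle by one step first gives the same for the other neighbor.\<close>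

lemma ear_good:
  assumes c: "cyc n c" and nc: "\<And>k. no_chord n (\<lambda>i. c (k + i))"
    and y0: "y0 \<in> X - c ` {..<n}" "adj (c 0) y0"
  shows "good (c 0)"
proof -
  have n: "4 \<le> n" using c by (simp add: cyc_def)
  have cX: "c i \<in> X" for i using c by (simp add: cyc_def)
  have per: "c (i + n) = c i" for i using c by (simp add: cyc_def)
  have inj: "c i \<noteq> c j" if "i < n" "j < n" "i \<noteq> j" for i j
    using cyc_neq[OF c] that by blast
  have nc0: "no_chord n c" using nc[of 0] by simp
  define W where "W = c ` {1..<n}"
  have CW: "c ` {..<n} = insert (c 0) W"
  proof -
    have "{..<n} = insert 0 {1..<n}" using n by auto
    then show ?thesis by (simp add: W_def)
  qed
  have W: "W \<subseteq> X - {c 0}" "W \<noteq> {}"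
    using n cX inj[of _ 0] by (auto simp: W_def)
  have key: "\<phi> (c 1) = \<phi> y \<and> \<phi> (c 2) = \<phi> y"
    if st: "St (c 0) \<phi>" and y: "y \<in> X - c ` {..<n}" "adj (c 0) y" for \<phi> y
  proof -
    have yW: "y \<in> X - {c 0} - W" using y CW by auto
    obtain t w where t: "t \<in> X - {c 0} - W" "w \<in> W" "adj t w"
      and tr: "\<And>\<phi>. St y \<phi> \<Longrightarrow> \<exists>\<phi>'. St t \<phi>' \<and> (\<forall>u. u \<notin> X - {c 0} - W \<longrightarrow> \<phi>' u = \<phi> u)"
      using travel[OF cX W yW] by metis
    obtain j where j: "w = c j" "1 \<le> j" "j < n" using t by (auto simp: W_def)
    \<comment> \<open>Seen from the re-entry point \<open>c j\<close>, the cycle is again chordless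
      and carries its old colors, except that \<open>c 0\<close> has the color of \<open>y\<close>.
      The cases come from comparing the relations for the base points \<open>c 0\<close> and
      \<open>c j\<close>.\<close>
    have ear: "(j = 1 \<longrightarrow> \<phi> y = \<phi> (c 1)) \<and> (j = n - 1 \<longrightarrow> \<phi> y = \<phi> (c 2)) \<and>
       (1 < j \<and> j < n - 1 \<longrightarrow> \<phi> y = \<phi> (c 1) \<and> \<phi> y = \<phi> (c 2))"
      if st: "St (c 0) \<phi>" for \<phi>
    proof -
      obtain \<phi>' where p: "St t \<phi>'"
          "\<forall>u. u \<notin> X - {c 0} - W \<longrightarrow> \<phi>' u = (\<phi>(c 0 := \<phi> y)) u"
        using tr[OF slide[OF st cX]] y by blast
      define \<psi> where "\<psi> = \<phi>'(t := \<phi>' w)"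
      have s: "St (c j) \<psi>" unfolding \<psi>_def using slide[OF p(1), of w] t cX j by auto
      have t0: "t \<noteq> c 0" "t \<notin> W" using t by auto
      have v0: "\<psi> (c 0) = \<phi> y" using p(2) t0 by (auto simp: \<psi>_def)
      have v: "\<psi> (c i) = \<phi> (c i)" if "1 \<le> i" "i < n" for i
      proof -
        have "c i \<in> W" "c i \<noteq> c 0" using that inj[of i 0] n by (auto simp: W_def)
        then show ?thesis using p(2) t0 by (auto simp: \<psi>_def)
      qed
      let ?c = "\<lambda>i. c (j + i)"
      have c': "cyc n ?c" "no_chord n ?c" "St (?c 0) \<psi>"
        using cyc_shift[OF c] nc s by simp_all
      note two = cyc_two_apart[OF c nc0 st] and two' = cyc_two_apart[OF c']
      note las = cyc_last[OF c nc0 st] and las' = cyc_last[OF c']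
      have l1: "?c (n - 1) = c (j - 1)" using per[of "j - 1"] j n by (simp add: add.commute)
      have A: "\<phi> y = \<phi> (c 1)" if "j = 1"
      proof -
        have "\<psi> (c 0) = \<psi> (c 3)" using las' l1 that by (simp add: numeral_3_eq_3 numeral_2_eq_2)
        then show ?thesis using v0 v[of 3] two[of 1] n by (simp add: numeral_3_eq_3)
      qed
      have B: "\<phi> y = \<phi> (c 2)" if "j = n - 1"
      proof -
        have "?c 1 = c 0" using per[of 0] that n by simp
        moreover have "?c 3 = c 2" using per[of 2] that n by (simp add: numeral_3_eq_3 numeral_2_eq_2)
        ultimately show ?thesis using two'[of 1] v0 v[of 2] n by (simp add: numeral_3_eq_3)
      qed
      \<comment> \<open>From the base point \<open>c j\<close>, the vertices
        \<open>c (n - 1)\<close> and \<open>c 1\<close> are two apart across \<open>c 0\<close>.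
        With \<open>cyc_last\<close> at \<open>c 0\<close> this identifies the colors of
        \<open>c 1\<close> and \<open>c 2\<close>, so the cycle is monochromatic and it is enough to
        match \<open>c 0\<close> with any one vertex. If \<open>n - j = 2\<close>, the vertex two
        before \<open>c 0\<close> is the hole, and \<open>cyc_last\<close> replaces
        \<open>cyc_two_apart\<close>.\<close>
      have C: "\<phi> y = \<phi> (c 1) \<and> \<phi> y = \<phi> (c 2)" if j1: "1 < j" "j < n - 1"
      proof -
        have c0: "?c (n - j) = c 0" using per[of 0] j by simp
        have c1: "?c (n - j + 1) = c 1" using per[of 1] j by simp
        have cm: "?c (n - j - 1) = c (n - 1)" using j1 by simp
        have "\<psi> (c (n - 1)) = \<psi> (c 1)" using two'[of "n - j - 1"] cm c1 j1 by simp
        then have e: "\<phi> (c 1) = \<phi> (c 2)" using v[of 1] v[of "n - 1"] las n by simp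
        have all: "\<phi> (c i) = \<phi> (c 1)" if "1 \<le> i" "i < n" for i
          using that
        proof (induction i rule: less_induct)
          case (less i)
          consider "i = 1" | "i = 2" | "3 \<le> i" using less.prems by linarith
          then show ?case
          proof cases
            case 3
            then have "i - 2 + 2 = i" "1 \<le> i - 2" by auto
            then have "\<phi> (c (i - 2)) = \<phi> (c i)" using two[of "i - 2"] less.prems by metis
            then show ?thesis using less.IH[of "i - 2"] 3 less.prems by simp
          qed (use e in auto)
        qed
        have "\<exists>i. 1 \<le> i \<and> i < n \<and> \<psi> (c 0) = \<psi> (c i)"
        proof (cases "n - j = 2")
          case True
          have "\<psi> (c (j - 1)) = \<psi> (c 0)" using las' l1 c0 True by simp
          then show ?thesis using j1 by (intro exI[of _ "j - 1"]) auto
        next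
          case False
          have "?c (n - j - 2) = c (n - 2)" using j1 False by simp
          moreover have "n - j - 2 + 2 = n - j" using j1 by simp
          then have "?c (n - j - 2 + 2) = c 0" using c0 by metis
          ultimately have "\<psi> (c (n - 2)) = \<psi> (c 0)" using two'[of "n - j - 2"] j1 False by simp
          then show ?thesis using n by (intro exI[of _ "n - 2"]) auto
        qed
        then show ?thesis using v0 v all e by metis
      qed
      show ?thesis using A B C by blast
    qed
    obtain \<phi>' where p: "St (c 0) \<phi>'" "\<And>i. 1 \<le> i \<Longrightarrow> i < n - 1 \<Longrightarrow> \<phi>' (c i) = \<phi> (c (Suc i))"
      "\<And>u. u \<notin> c ` {..<n} \<Longrightarrow> \<phi>' u = \<phi> u"
      using cyc_rotate[OF c st] by metis
    have p1: "\<phi>' (c 1) = \<phi> (c 2)" using p(2)[of 1] n by (simp add: numeral_2_eq_2)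
    have p2: "\<phi>' (c 2) = \<phi> (c 1)"
      using p(2)[of 2] cyc_two_apart[OF c nc0 st, of 1] n by (simp add: numeral_3_eq_3)
    have py: "\<phi>' y = \<phi> y" using p(3) y by blast
    consider "j = 1" | "j = n - 1" | "1 < j \<and> j < n - 1" using j by linarith
    then show ?thesis
    proof cases
      case 1
      then have "\<phi> y = \<phi> (c 1)" "\<phi>' y = \<phi>' (c 1)" using ear[OF st] ear[OF p(1)] by blast+
      then show ?thesis using p1 py by metis
    next
      case 2
      then have "\<phi> y = \<phi> (c 2)" "\<phi>' y = \<phi>' (c 2)" using ear[OF st] ear[OF p(1)] by blast+
      then show ?thesis using p2 py by metis
    next
      case 3
      then show ?thesis using ear[OF st] by metis
    qed
  qed
  have *: "\<phi> u = \<phi> y0" if st: "St (c 0) \<phi>" and u: "u \<in> X" "adj (c 0) u" for \<phi> u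
  proof (cases "u \<in> c ` {..<n}")
    case True
    then have "u = c 1 \<or> u = c (n - 1)" using nc0 u by (auto simp: no_chord_def)
    then show ?thesis using key[OF st y0] cyc_last[OF c nc0 st] by auto
  next
    case False
    then show ?thesis using key[OF st, of u] key[OF st y0] u by auto
  qed
  show ?thesis using * by (rule goodI)
qed

section \<open>Shortest detours and chordless cycles\<close>

lemma avoiding_path:
  assumes w: "w \<in> X" and x: "x \<in> X - {w}" and y: "y \<in> X - {w}"
  obtains p where "p \<noteq> []" "successively adj p" "set p \<subseteq> X - {w}" "hd p = x" "last p = y"
proof -
  define R where "R = {b \<in> X - {w}. \<exists>p. p \<noteq> [] \<and> successively adj p \<and> set p \<subseteq> X - {w} \<and> hd p = x \<and> last p = b}"
  have xR: "x \<in> R" using x by (auto simp: R_def intro!: exI[of _ "[x]"])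
  have "y \<in> R"
  proof (rule ccontr)
    assume "y \<notin> R"
    moreover have "R \<subseteq> X - {w}" by (auto simp: R_def)
    ultimately obtain a b where ab: "a \<in> R" "b \<in> X - {w}" "b \<notin> R" "adj a b"
      using connected_inD[OF conn_minus[OF w] _ xR y] by metis
    then obtain p where p: "p \<noteq> []" "successively adj p" "set p \<subseteq> X - {w}" "hd p = x" "last p = a"
      by (auto simp: R_def)
    have "b \<in> R" unfolding R_def
      using ab p by (auto simp: successively_append_iff intro!: exI[of _ "p @ [b]"])
    then show False using ab by simp
  qed
  then show ?thesis using that by (auto simp: R_def)
qed

lemma cyc_of_list:
  assumes n: "n = length xs" "4 \<le> n" and d: "distinct xs" "set xs \<subseteq> X" "successively adj xs"
    and close: "adj (last xs) (hd xs)"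
  shows "cyc n (\<lambda>i. xs ! (i mod n))"
proof -
  have ne: "xs \<noteq> []" using n by auto
  have "adj (xs ! (i mod n)) (xs ! (Suc i mod n))" for i
  proof (cases "Suc (i mod n) < n")
    case True
    then show ?thesis using d(3) n by (simp add: successively_conv_nth mod_Suc)
  next
    case False
    moreover have "0 < n" using n by linarith
    then have "i mod n < n" by simp
    ultimately have "Suc i mod n = 0" "i mod n = n - 1" by (auto simp: mod_Suc)
    then show ?thesis using close ne n by (simp add: last_conv_nth hd_conv_nth)
  qed
  moreover have "xs ! (i mod n) \<in> X" for i
  proof -
    have "0 < n" using n by linarith
    then have "i mod n < length xs" using n(1) mod_less_divisor by blast
    then show ?thesis using d nth_mem by blast
  qed
  moreover have "inj_on (\<lambda>i. xs ! (i mod n)) {..<n}"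
    using d n by (auto simp: inj_on_def nth_eq_iff_index_eq)
  ultimately show ?thesis using n(2) by (simp add: cyc_def)
qed

lemma chordless_list:
  assumes n: "n = length xs" "0 < n"
    and ch: "\<And>a b. a < b \<Longrightarrow> b < n \<Longrightarrow> adj (xs ! a) (xs ! b) \<Longrightarrow> b = Suc a \<or> a = 0 \<and> b = n - 1"
  shows "no_chord n (\<lambda>i. xs ! ((k + i) mod n))"
  unfolding no_chord_def
proof (intro allI impI)
  fix j assume j: "j < n" and adj: "adj (xs ! ((k + 0) mod n)) (xs ! ((k + j) mod n))"
  define a b where "a = k mod n" and "b = (k + j) mod n"
  have an: "a < n" "b < n" using n by (auto simp: a_def b_def)
  have "b = (a + j) mod n" by (simp add: a_def b_def mod_add_left_eq)
  then have b: "b = (if a + j < n then a + j else a + j - n)"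
    using an j by (simp add: le_mod_geq)
  have ab: "adj (xs ! a) (xs ! b)" "adj (xs ! b) (xs ! a)"
    using adj adj_sym by (auto simp: a_def b_def)
  then have "a \<noteq> b" using adj_irrefl by metis
  then consider "a < b" | "b < a" by linarith
  then show "j = 1 \<or> j = n - 1"
  proof cases
    case 1
    from ch[OF this an(2) ab(1)] show ?thesis using b an j by (auto split: if_splits)
  next
    case 2
    from ch[OF this an(1) ab(2)] show ?thesis using b an j by (auto split: if_splits)
  qed
qed

text \<open>A shortest detour has no shortcuts, so closing it up through \<open>w\<close> gives a cycle whose only
  possible chord joins \<open>w\<close> to the middle vertex of a detour with three vertices.\<close>

definition detour :: "'a \<Rightarrow> 'a list \<Rightarrow> bool" where
  "detour w p \<longleftrightarrow> w \<in> X \<and> p \<noteq> [] \<and> successively adj p \<and> set p \<subseteq> X - {w} \<and>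
     adj w (hd p) \<and> adj w (last p) \<and> hd p \<noteq> last p \<and> \<not> adj (hd p) (last p)"

text \<open>An edge leaving the closed neighborhood of \<open>x\<close> yields a vertex
  \<open>z\<close> nonadjacent to \<open>x\<close> with a common neighbor \<open>w\<close>; deleting
  \<open>w\<close> leaves \<open>x\<close> and \<open>z\<close> connected.\<close>

lemma detour_exists:
  assumes "x \<in> X" "y \<in> X" "x \<noteq> y" "\<not> adj x y"
  obtains w p where "detour w p"
proof -
  obtain w z where w: "w \<in> insert x {u \<in> X. adj x u}" "z \<in> X" "z \<notin> insert x {u \<in> X. adj x u}" "adj w z"
    using connected_inD[OF conn, of "insert x {u \<in> X. adj x u}" x y] assms by auto
  then have w': "adj x w" "w \<in> X" "z \<noteq> x" "\<not> adj x z" by auto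
  have "x \<in> X - {w}" "z \<in> X - {w}" using w w' assms adj_irrefl by auto
  then obtain p where "p \<noteq> []" "successively adj p" "set p \<subseteq> X - {w}" "hd p = x" "last p = z"
    using avoiding_path[OF w'(2)] by metis
  then have "detour w p" unfolding detour_def using w w' adj_sym by auto
  then show ?thesis using that by blast
qed

text \<open>A detour of least length, over all choices of \<open>w\<close>, closes up to a 4-cycle
  with a diagonal, to a chordless cycle missing a vertex of \<open>X\<close>, or to a chordless
  cycle through all of \<open>X\<close>. The first two produce a good vertex.\<close>

lemma noncomplete_good_or_cycle:
  assumes xy: "x \<in> X" "y \<in> X" "x \<noteq> y" "\<not> adj x y"
  shows "(\<forall>v\<in>X. good v) \<or> 4 \<le> card X \<and> (\<forall>v\<in>X. card {u \<in> X. adj v u} = 2)"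
proof -
  obtain w0 p0 where "detour w0 p0" using detour_exists[OF xy] by metis
  then have "\<exists>q. detour (fst q) (snd q)" by auto
  then obtain q where q: "detour (fst q) (snd q)"
      "\<And>q'. detour (fst q') (snd q') \<Longrightarrow> length (snd q) \<le> length (snd q')"
    using ex_has_least_nat[of "\<lambda>q. detour (fst q) (snd q)" _ "\<lambda>q. length (snd q)"] by blast
  obtain w p where "q = (w, p)" by fastforce
  then have D: "detour w p" and min: "\<And>w' p'. detour w' p' \<Longrightarrow> length p \<le> length p'"
    using q by auto
  define m where "m = length p"
  have Dp: "w \<in> X" "p \<noteq> []" "successively adj p" "set p \<subseteq> X - {w}" "adj w (hd p)" "adj w (last p)"
     "hd p \<noteq> last p" "\<not> adj (hd p) (last p)" using D by (auto simp: detour_def)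
  have h: "hd p = p ! 0" "last p = p ! (m - 1)" using Dp by (auto simp: hd_conv_nth last_conv_nth m_def)
  have m: "3 \<le> m"
  proof (rule ccontr)
    assume "\<not> 3 \<le> m"
    moreover have "m \<noteq> 0" using Dp by (simp add: m_def)
    ultimately consider "m = 1" | "m = 2" by linarith
    then show False
    proof cases
      case 1 then show False using h Dp by simp
    next
      case 2
      then have "adj (p ! 0) (p ! Suc 0)" using Dp(3) by (simp add: successively_conv_nth m_def)
      then show False using h Dp 2 by simp
    qed
  qed
  have tk: "successively adj (take i p)" and dr: "successively adj (drop i p)" for i
    using Dp(3) successively_append_iff[of adj "take i p" "drop i p"] by auto
  have st: "set (take i p) \<subseteq> X - {w}" "set (drop i p) \<subseteq> X - {w}" for i
    using Dp(4) set_take_subset[of i p] set_drop_subset[of i p] by auto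
  have short: "j \<le> Suc i" if ij: "i < j" "j < m" "adj (p ! i) (p ! j)" for i j
  proof -
    let ?q = "take (Suc i) p @ drop j p"
    have "last (take (Suc i) p) = p ! i" using ij by (simp add: take_Suc_conv_app_nth m_def)
    then have "successively adj ?q" unfolding successively_append_iff
      using tk dr ij by (simp add: m_def hd_drop_conv_nth)
    moreover have "hd ?q = hd p" "last ?q = last p" using ij Dp(2) by (simp_all add: m_def hd_append)
    moreover have "?q \<noteq> []" using ij by (simp add: m_def)
    moreover have "set ?q \<subseteq> X - {w}" using st by auto
    ultimately have "detour w ?q" using Dp unfolding detour_def by metis
    from min[OF this] show ?thesis using ij by (simp add: m_def)
  qed
  have dist: "p ! i \<noteq> p ! j" if ij: "i < j" "j < m" for i j
  proof
    assume eq: "p ! i = p ! j"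
    let ?q = "take i p @ drop j p"
    have a: "adj (p ! (i - 1)) (p ! j)" if "i \<noteq> 0"
      using Dp(3) ij that eq unfolding successively_conv_nth m_def by (metis Suc_diff_1 Suc_lessD gr0I less_trans not_less_eq)
    have "hd ?q = hd p" using ij eq Dp(2) by (cases "i = 0") (auto simp: m_def hd_drop_conv_nth hd_append hd_conv_nth[of p])
    moreover have "last ?q = last p" using ij by (simp add: m_def)
    moreover have "last (take i p) = p ! (i - 1)" if "i \<noteq> 0"
      using ij that Dp(2) by (simp add: last_conv_nth m_def)
    then have "successively adj ?q" unfolding successively_append_iff
      using tk dr a ij by (cases "i = 0") (simp_all add: m_def hd_drop_conv_nth)
    moreover have "?q \<noteq> []" using ij by (simp add: m_def)
    moreover have "set ?q \<subseteq> X - {w}" using st by auto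
    ultimately have "detour w ?q" using Dp unfolding detour_def by metis
    from min[OF this] show False using ij by (simp add: m_def)
  qed
  \<comment> \<open>If an inner neighbor of \<open>w\<close> were nonadjacent to an end of
    \<open>p\<close>, the piece between them would be a shorter detour. So it is adjacent to both
    ends, and without shortcuts it is the middle of three vertices.\<close>
  have chord: "i = 1 \<and> m = 3" if i: "0 < i" "i < m - 1" "adj w (p ! i)" for i
  proof
    have "adj (p ! 0) (p ! i)"
    proof (rule ccontr)
      assume na: "\<not> adj (p ! 0) (p ! i)"
      have "last (take (Suc i) p) = p ! i" using i by (simp add: take_Suc_conv_app_nth m_def)
      then have "detour w (take (Suc i) p)" unfolding detour_def
        using Dp tk st i na h dist[of 0 i] by auto
      from min[OF this] show False using i by (simp add: m_def)
    qed
    moreover have "i < m" using i by linarith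
    ultimately show i1: "i = 1" using short[of 0 i] i by simp
    have "adj (p ! i) (p ! (m - 1))"
    proof (rule ccontr)
      assume na: "\<not> adj (p ! i) (p ! (m - 1))"
      have "hd (drop i p) = p ! i" "last (drop i p) = p ! (m - 1)"
        using i h by (simp_all add: hd_drop_conv_nth m_def)
      then have "detour w (drop i p)" unfolding detour_def
        using Dp dr st i na h dist[of i "m - 1"] by (auto simp: m_def)
      from min[OF this] show False using i by (simp add: m_def)
    qed
    then show "m = 3" using short[of i "m - 1"] i i1 m by simp
  qed
  have dp: "distinct p" unfolding distinct_conv_nth
    using dist by (metis m_def nat_neq_iff)
  show ?thesis
  proof (cases "\<exists>i. 0 < i \<and> i < m - 1 \<and> adj w (p ! i)")
    case True
    then have m3: "m = 3" using chord by auto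
    \<comment> \<open>The start \<open>p ! 0\<close> is chosen because its opposite vertex
      \<open>p ! 2\<close> is nonadjacent to it; the chord from \<open>w\<close> to
      \<open>p ! 1\<close> is the other diagonal.\<close>
    let ?xs = "[p ! 0, w, p ! 2, p ! 1]"
    have "adj (p ! 0) (p ! 1)" "adj (p ! 1) (p ! 2)"
      using Dp(3) m3 by (auto simp: successively_conv_nth m_def numeral_2_eq_2)
    moreover have "p ! i \<in> X - {w}" if "i < 3" for i using subsetD[OF Dp(4) nth_mem] that m3 by (simp add: m_def)
    then have "p ! 0 \<in> X - {w}" "p ! 1 \<in> X - {w}" "p ! 2 \<in> X - {w}" by simp_all
    ultimately have "cyc 4 (\<lambda>i. ?xs ! (i mod 4))"
      using Dp h m3 dist[of 0 1] dist[of 0 2] dist[of 1 2] adj_sym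
      by (intro cyc_of_list) auto
    moreover have "no_chord 4 (\<lambda>i. ?xs ! (i mod 4))" unfolding no_chord_def
    proof (intro allI impI)
      fix j :: nat assume "j < 4" "adj (?xs ! (0 mod 4)) (?xs ! (j mod 4))"
      then show "j = 1 \<or> j = 4 - 1"
        using Dp h m3 adj_irrefl by (cases "j = 0"; cases "j = 2") (auto simp: numeral_2_eq_2)
    qed
    ultimately have "good (?xs ! (0 mod 4))" by (rule four_cycle_good)
    moreover have "p ! 0 \<in> X" using subsetD[OF Dp(4) nth_mem, of 0] Dp(2) by simp
    ultimately show ?thesis using good_all by simp
  next
    case False
    define n where "n = Suc m"
    let ?xs = "w # p"
    define c where "c = (\<lambda>i. ?xs ! (i mod n))"
    have n4: "4 \<le> n" using m by (simp add: n_def)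
    have c: "cyc n c" unfolding c_def
      using Dp dp m adj_sym by (intro cyc_of_list) (auto simp: n_def m_def successively_Cons)
    have nc: "no_chord n (\<lambda>i. c (k + i))" for k unfolding c_def
    proof (rule chordless_list)
      fix a b assume ab: "a < b" "b < n" "adj (?xs ! a) (?xs ! b)"
      show "b = Suc a \<or> a = 0 \<and> b = n - 1"
      proof (cases "a = 0")
        case True
        then have "adj w (p ! (b - 1))" using ab by (cases b) auto
        then have "\<not> (0 < b - 1 \<and> b - 1 < m - 1)" using False by blast
        then show ?thesis using ab True by (auto simp: n_def)
      next
        case a0: False
        then have "adj (p ! (a - 1)) (p ! (b - 1))" using ab by (simp add: nth_Cons')
        then have "b - 1 \<le> Suc (a - 1)" using short[of "a - 1" "b - 1"] ab a0 by (simp add: n_def)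
        then show ?thesis using ab a0 by linarith
      qed
    qed (auto simp: n_def m_def)
    have cX: "c ` {..<n} \<subseteq> X" using c by (auto simp: cyc_def)
    show ?thesis
    proof (cases "c ` {..<n} = X")
      case True
      have cardX: "card X = n" using True c card_image[of c "{..<n}"] by (simp add: cyc_def)
      have "card {u \<in> X. adj v u} = 2" if v: "v \<in> X" for v
      proof -
        obtain k where k: "v = c k" using v True by auto
        define d where "d = (\<lambda>i. c (k + i))"
        have d: "cyc n d" "no_chord n d" using cyc_shift[OF c] nc by (simp_all add: d_def)
        have "d ` {..<n} \<subseteq> X" "card (d ` {..<n}) = card X"
          using d(1) card_image[of d "{..<n}"] cardX by (auto simp: cyc_def)
        then have dX: "d ` {..<n} = X" using fin by (simp add: card_subset_eq)
        have "adj (d 0) (d 1)" using d(1) by (auto simp: cyc_def)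
        moreover have "adj (d 0) (d (n - 1))" by (rule adj_sym[OF cyc_last_adj[OF d(1)]])
        moreover have "d 1 \<in> X" "d (n - 1) \<in> X" using d(1) by (auto simp: cyc_def)
        moreover have "u = d 1 \<or> u = d (n - 1)" if u: "u \<in> X" "adj (d 0) u" for u
        proof -
          obtain j where "j < n" "u = d j" using u dX by auto
          then show ?thesis using d(2) u by (auto simp: no_chord_def)
        qed
        ultimately have "{u \<in> X. adj (d 0) u} = {d 1, d (n - 1)}" by blast
        moreover have "d 1 \<noteq> d (n - 1)" using cyc_neq[OF d(1)] n4 by simp
        ultimately show ?thesis using k by (simp add: d_def)
      qed
      then show ?thesis using cardX n4 by auto
    next
      case False
      then obtain z where "z \<in> X" "z \<notin> c ` {..<n}" using cX by blast
      moreover have "c 0 \<in> c ` {..<n}" using n4 by auto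
      ultimately obtain a b where ab: "a \<in> c ` {..<n}" "b \<in> X" "b \<notin> c ` {..<n}" "adj a b"
        using connected_inD[OF conn cX] by metis
      then obtain k where k: "a = c k" by auto
      have "(\<lambda>i. c (k + i)) ` {..<n} \<subseteq> c ` {..<n}" using cyc_image[OF c] by auto
      then have "b \<in> X - (\<lambda>i. c (k + i)) ` {..<n}" using ab by auto
      then have "good (c (k + 0))"
        using ear_good[OF cyc_shift[OF c], of k b] nc ab k by (simp add: add.assoc[symmetric])
      then show ?thesis using good_all cX ab k by auto
    qed
  qed
qed

end

section \<open>Gallai's bound for hypergraphs with prescribed blocks\<close>

definition gallai_slope :: "nat \<Rightarrow> real" where
  "gallai_slope \<delta> = real \<delta> - 1 + 2 / real \<delta>"

text \<open>The four facts serve, in order, cycles, complete graphs on fewer than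
  \<open>\<delta>\<close> vertices, blocks of degree at most \<open>r\<close>, and complete graphs
  on \<open>\<delta>\<close> vertices; 8/3 is the value at \<open>\<delta> = 3\<close>.\<close>

lemma gallai_slope_bounds:
  assumes "3 \<le> \<delta>"
  shows "8 / 3 \<le> gallai_slope \<delta>" "real \<delta> - 1 \<le> gallai_slope \<delta>" "3 / 4 * real \<delta> \<le> gallai_slope \<delta>"
    "(real \<delta> - 1) * (real \<delta> - gallai_slope \<delta>) = gallai_slope \<delta> - 2"
proof -
  have d: "3 \<le> real \<delta>" using assms by simp
  have "0 \<le> (3 * real \<delta> - 2) * (real \<delta> - 3) / (3 * real \<delta>)" using d by simp
  also have "\<dots> = gallai_slope \<delta> - 8 / 3" using d by (simp add: gallai_slope_def field_simps)
  finally show "8 / 3 \<le> gallai_slope \<delta>" by simp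
  show "real \<delta> - 1 \<le> gallai_slope \<delta>" by (simp add: gallai_slope_def)
  have "0 \<le> ((real \<delta> - 2)\<^sup>2 + 4) / (4 * real \<delta>)" using d by simp
  also have "\<dots> = gallai_slope \<delta> - 3 / 4 * real \<delta>"
    using d by (simp add: gallai_slope_def field_simps power2_eq_square)
  finally show "3 / 4 * real \<delta> \<le> gallai_slope \<delta>" by simp
  show "(real \<delta> - 1) * (real \<delta> - gallai_slope \<delta>) = gallai_slope \<delta> - 2"
    using d by (simp add: gallai_slope_def field_simps)
qed

section \<open>Degrees in a hyperedge system and splitting at a cut vertex\<close>

locale edge_system =
  fixes ES :: "'e set" and f :: "'e \<Rightarrow> 'v set"
  assumes finES: "finite ES" and edge2: "e \<in> ES \<Longrightarrow> 2 \<le> card (f e)"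
begin

definition deg :: "'v set \<Rightarrow> 'v \<Rightarrow> nat" where
  "deg X v = card {e \<in> ES. v \<in> f e \<and> f e \<subseteq> X}"

definition adj :: "'v \<Rightarrow> 'v \<Rightarrow> bool" where
  "adj u v \<longleftrightarrow> u \<noteq> v \<and> (\<exists>e\<in>ES. u \<in> f e \<and> v \<in> f e)"

text \<open>For such sets, keeping only the hyperedges inside \<open>X\<close> loses none that joins
  two vertices of \<open>X\<close>, so \<open>deg X\<close> and \<open>adj\<close> on
  \<open>X\<close> describe the same hypergraph.\<close>

definition edge_closed :: "'v set \<Rightarrow> bool" where
  "edge_closed X \<longleftrightarrow> (\<forall>e\<in>ES. \<forall>u\<in>X. \<forall>v\<in>X. u \<noteq> v \<longrightarrow> u \<in> f e \<longrightarrow> v \<in> f e \<longrightarrow> f e \<subseteq> X)"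

lemma adj_sym: "adj u v \<Longrightarrow> adj v u"
  by (auto simp: adj_def)

lemma two_in_edge:
  assumes "e \<in> ES"
  obtains u v where "u \<in> f e" "v \<in> f e" "u \<noteq> v"
proof -
  obtain T where "T \<subseteq> f e" "card T = 2" using obtain_subset_with_card_n[OF edge2[OF assms]] by metis
  then show ?thesis using that by (auto simp: card_2_iff)
qed

lemma other_in_edge:
  assumes "e \<in> ES"
  obtains u where "u \<in> f e" "u \<noteq> v"
  using two_in_edge[OF assms] by metis

lemma deg_mono: "X \<subseteq> Y \<Longrightarrow> deg X v \<le> deg Y v"
  unfolding deg_def using finES by (intro card_mono) auto

lemma deg_outside: "v \<notin> X \<Longrightarrow> deg X v = 0"
  unfolding deg_def by (auto simp: card_eq_0_iff)

lemma deg_pos: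
  assumes "edge_closed X" "u \<in> X" "v \<in> X" "adj u v"
  shows "0 < deg X u"
proof -
  obtain e where "e \<in> ES" "u \<in> f e" "v \<in> f e" "u \<noteq> v" using assms by (auto simp: adj_def)
  then have "e \<in> {e \<in> ES. u \<in> f e \<and> f e \<subseteq> X}" using assms unfolding edge_closed_def by blast
  then show ?thesis unfolding deg_def using finES by (auto simp: card_gt_0_iff)
qed

lemma deg_le_others:
  assumes "finite X"
  shows "deg X x \<le> (\<Sum>y\<in>X - {x}. deg X y)"
proof -
  have "{e \<in> ES. x \<in> f e \<and> f e \<subseteq> X} \<subseteq> (\<Union>y\<in>X - {x}. {e \<in> ES. y \<in> f e \<and> f e \<subseteq> X})"
  proof
    fix e assume e: "e \<in> {e \<in> ES. x \<in> f e \<and> f e \<subseteq> X}"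
    then obtain u where "u \<in> f e" "u \<noteq> x" using other_in_edge by blast
    then show "e \<in> (\<Union>y\<in>X - {x}. {e \<in> ES. y \<in> f e \<and> f e \<subseteq> X})" using e by auto
  qed
  then have "deg X x \<le> card (\<Union>y\<in>X - {x}. {e \<in> ES. y \<in> f e \<and> f e \<subseteq> X})"
    unfolding deg_def using finES assms by (intro card_mono) auto
  also have "\<dots> \<le> (\<Sum>y\<in>X - {x}. deg X y)"
    unfolding deg_def using assms by (intro card_UN_le) auto
  finally show ?thesis .
qed

context
  fixes A B :: "'v set" and y :: 'v
  assumes closed: "edge_closed (A \<union> B)" and AB: "A \<inter> B \<subseteq> {y}"
    and nadj: "\<forall>a\<in>A - B. \<forall>b\<in>B - A. \<not> adj a b"
begin

lemma edge_in_part: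
  assumes "e \<in> ES" "f e \<subseteq> A \<union> B"
  shows "f e \<subseteq> A \<or> f e \<subseteq> B"
proof (rule ccontr)
  assume "\<not> ?thesis"
  then obtain a b where ab: "a \<in> f e" "a \<notin> B" "b \<in> f e" "b \<notin> A" by auto
  then have "a \<in> A - B" "b \<in> B - A" using assms by auto
  moreover from this have "adj a b" using ab assms unfolding adj_def by blast
  ultimately show False using nadj by blast
qed

lemma split_closed: "edge_closed A"
  unfolding edge_closed_def
proof (intro ballI impI)
  fix e u v assume h: "e \<in> ES" "u \<in> A" "v \<in> A" "u \<noteq> v" "u \<in> f e" "v \<in> f e"
  then have "f e \<subseteq> A \<union> B" using closed unfolding edge_closed_def by blast
  moreover have "\<not> f e \<subseteq> B" using AB h by auto
  ultimately show "f e \<subseteq> A" using edge_in_part h by blast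
qed

lemma split_deg: "deg (A \<union> B) v = deg A v + deg B v"
proof -
  have "{e \<in> ES. v \<in> f e \<and> f e \<subseteq> A \<union> B} =
      {e \<in> ES. v \<in> f e \<and> f e \<subseteq> A} \<union> {e \<in> ES. v \<in> f e \<and> f e \<subseteq> B}"
    using edge_in_part by auto
  moreover have "{e \<in> ES. v \<in> f e \<and> f e \<subseteq> A} \<inter> {e \<in> ES. v \<in> f e \<and> f e \<subseteq> B} = {}"
  proof (rule ccontr)
    assume "\<not> ?thesis"
    then obtain e where e: "e \<in> ES" "f e \<subseteq> A" "f e \<subseteq> B" by auto
    obtain a b where "a \<in> f e" "b \<in> f e" "a \<noteq> b" using two_in_edge[OF e(1)] by metis
    then show False using AB e by blast
  qed
  ultimately show ?thesis unfolding deg_def using finES by (simp add: card_Un_disjoint)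
qed

lemma split_sum:
  assumes "finite A" "finite B"
  shows "(\<Sum>v\<in>A \<union> B. deg (A \<union> B) v) = (\<Sum>v\<in>A. deg A v) + (\<Sum>v\<in>B. deg B v)"
proof -
  have "(\<Sum>v\<in>A \<union> B. deg (A \<union> B) v) = (\<Sum>v\<in>A \<union> B. deg A v) + (\<Sum>v\<in>A \<union> B. deg B v)"
    by (simp add: split_deg sum.distrib)
  also have "(\<Sum>v\<in>A \<union> B. deg A v) = (\<Sum>v\<in>A. deg A v)"
    using assms by (intro sum.mono_neutral_right) (auto simp: deg_outside)
  also have "(\<Sum>v\<in>A \<union> B. deg B v) = (\<Sum>v\<in>B. deg B v)"
    using assms by (intro sum.mono_neutral_right) (auto simp: deg_outside)
  finally show ?thesis .
qed

end

text \<open>A pendant vertex of \<open>X\<close> carries an extra charge, which pays for a complete graph on \<open>\<delta>\<close>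
  vertices that may hang at it outside \<open>X\<close>.\<close>

definition pend :: "'v set \<Rightarrow> 'v \<Rightarrow> 'v set" where
  "pend X x = {y \<in> X - {x}. deg X y = 1}"

text \<open>The term \<open>card X - 1\<close> makes this additive when two sets are glued at one
  vertex. The root \<open>x\<close> carries no charge, since other parts may be glued on
  there.\<close>

definition excess :: "real \<Rightarrow> 'v set \<Rightarrow> 'v \<Rightarrow> real" where
  "excess c X x = real (\<Sum>v\<in>X. deg X v) - c * (real (card X) - 1) + (c - 2) * real (card (pend X x))"

text \<open>The parts interact only at \<open>y\<close>: as root of \<open>B\<close> it is not
  charged there, and if pendant in \<open>A\<close> it has degree at least 2 in the union and loses
  its charge.\<close>

lemma split_excess:
  assumes "edge_closed (A \<union> B)" "A \<inter> B = {y}" "finite A" "finite B"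
    and "\<forall>a\<in>A - B. \<forall>b\<in>B - A. \<not> adj a b"
    and "x \<in> A" "x \<noteq> y" "0 < deg A y" "0 < deg B y"
  shows "excess c (A \<union> B) x = excess c A x + excess c B y - (if deg A y = 1 then c - 2 else 0)"
proof -
  have AB: "A \<inter> B \<subseteq> {y}" using assms by simp
  note sd = split_deg[OF assms(1) AB assms(5)]
  note ss = split_sum[OF assms(1) AB assms(5) assms(3,4)]
  have out: "deg B v = 0" if "v \<in> A" "v \<noteq> y" for v using that assms(2) by (intro deg_outside) auto
  have out': "deg A v = 0" if "v \<in> B" "v \<noteq> y" for v using that assms(2) by (intro deg_outside) auto
  have y: "y \<in> A" "y \<in> B" using assms by auto
  have xB: "x \<notin> B" using assms by blast
  have "pend (A \<union> B) x = (pend A x - {y}) \<union> pend B y"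
    using assms(6-9) out out' y xB by (auto simp: pend_def sd deg_outside)
  moreover have "(pend A x - {y}) \<inter> pend B y = {}" using assms(2) by (auto simp: pend_def)
  moreover have fin: "finite (pend A x)" "finite (pend B y)" using assms by (auto simp: pend_def)
  ultimately have p: "card (pend (A \<union> B) x) = card (pend A x - {y}) + card (pend B y)"
    by (simp add: card_Un_disjoint)
  have mem: "y \<in> pend A x \<longleftrightarrow> deg A y = 1" using assms(7) y by (auto simp: pend_def)
  have p': "real (card (pend A x - {y})) = real (card (pend A x)) - (if deg A y = 1 then 1 else 0)"
  proof (cases "deg A y = 1")
    case True
    then have "0 < card (pend A x)" using mem fin by (auto simp: card_gt_0_iff)
    then show ?thesis using mem True fin by (simp add: of_nat_diff)
  qed (use mem in simp)
  have "card (A \<union> B) + 1 = card A + card B" using card_Un_Int[OF assms(3,4)] assms(2) by simp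
  then have "real (card (A \<union> B)) - 1 = (real (card A) - 1) + (real (card B) - 1)" by linarith
  then have cc: "c * (real (card (A \<union> B)) - 1) = c * (real (card A) - 1) + c * (real (card B) - 1)"
    by (simp only: distrib_left)
  show ?thesis unfolding excess_def ss p cc by (auto simp: p' algebra_simps)
qed

lemma split_excess_root:
  assumes "edge_closed (A \<union> B)" "A \<inter> B = {x}" "finite A" "finite B"
    and "\<forall>a\<in>A - B. \<forall>b\<in>B - A. \<not> adj a b"
  shows "excess c (A \<union> B) x = excess c A x + excess c B x"
proof -
  have AB: "A \<inter> B \<subseteq> {x}" using assms by simp
  note sd = split_deg[OF assms(1) AB assms(5)]
  note ss = split_sum[OF assms(1) AB assms(5) assms(3,4)]
  have out: "deg B v = 0" if "v \<in> A" "v \<noteq> x" for v using that assms(2) by (intro deg_outside) auto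
  have out': "deg A v = 0" if "v \<in> B" "v \<noteq> x" for v using that assms(2) by (intro deg_outside) auto
  have "pend (A \<union> B) x = pend A x \<union> pend B x"
    using out out' by (auto simp: pend_def sd deg_outside)
  moreover have "pend A x \<inter> pend B x = {}" using assms(2) by (auto simp: pend_def)
  moreover have "finite (pend A x)" "finite (pend B x)" using assms by (auto simp: pend_def)
  ultimately have p: "card (pend (A \<union> B) x) = card (pend A x) + card (pend B x)"
    by (simp add: card_Un_disjoint)
  have "card (A \<union> B) + 1 = card A + card B" using card_Un_Int[OF assms(3,4)] assms(2) by simp
  then have "real (card (A \<union> B)) - 1 = (real (card A) - 1) + (real (card B) - 1)" by linarith
  then have cc: "c * (real (card (A \<union> B)) - 1) = c * (real (card A) - 1) + c * (real (card B) - 1)"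
    by (simp only: distrib_left)
  show ?thesis unfolding excess_def ss p cc by (simp add: algebra_simps)
qed

text \<open>Without a shared vertex, \<open>card X - 1\<close> costs one more \<open>c\<close>; the
  root \<open>y\<close> of \<open>B\<close> becomes an ordinary vertex of the union and is charged
  if pendant.\<close>

lemma split_excess_disjoint:
  assumes "edge_closed (A \<union> B)" "A \<inter> B = {}" "finite A" "finite B"
    and "\<forall>a\<in>A - B. \<forall>b\<in>B - A. \<not> adj a b"
    and "x \<in> A" "y \<in> B"
  shows "excess c (A \<union> B) x = excess c A x + excess c B y - c + (if deg B y = 1 then c - 2 else 0)"
proof -
  have AB: "A \<inter> B \<subseteq> {y}" using assms by simp
  note sd = split_deg[OF assms(1) AB assms(5)]
  note ss = split_sum[OF assms(1) AB assms(5) assms(3,4)]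
  have out: "deg B v = 0" if "v \<in> A" for v using that assms(2) by (intro deg_outside) auto
  have out': "deg A v = 0" if "v \<in> B" for v using that assms(2) by (intro deg_outside) auto
  have xB: "x \<notin> B" using assms by blast
  let ?Y = "if deg B y = 1 then {y} else {}"
  have "pend (A \<union> B) x = pend A x \<union> (pend B y \<union> ?Y)"
    using out out' xB assms(7) by (auto simp: pend_def sd deg_outside)
  moreover have "pend A x \<inter> (pend B y \<union> ?Y) = {}" using assms(2,7) by (auto simp: pend_def)
  moreover have fin: "finite (pend A x)" "finite (pend B y)" using assms by (auto simp: pend_def)
  moreover have "card (pend B y \<union> ?Y) = card (pend B y) + (if deg B y = 1 then 1 else 0)"
    using fin by (auto simp: pend_def)
  ultimately have p: "card (pend (A \<union> B) x) = card (pend A x) + (card (pend B y) + (if deg B y = 1 then 1 else 0))"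
    by (simp add: card_Un_disjoint)
  have "card (A \<union> B) = card A + card B" using card_Un_disjoint[OF assms(3,4)] assms(2) by simp
  then show ?thesis unfolding excess_def ss p by (simp add: algebra_simps)
qed

end

section \<open>Excess of blocks and the induction over cut vertices\<close>

locale block_bounds = edge_system +
  fixes U :: "'b set" and \<delta> r :: nat
  assumes finU: "finite U" and edgeU: "e \<in> ES \<Longrightarrow> f e \<subseteq> U"
    and d3: "3 \<le> \<delta>" and r2: "2 * r \<le> \<delta>"
    and deg_le: "deg U v \<le> \<delta>"
    and two: "X \<subseteq> U \<Longrightarrow> card X = 2 \<Longrightarrow> v \<in> X \<Longrightarrow> deg X v \<le> 1"
    and blocks: "X \<subseteq> U \<Longrightarrow> edge_closed X \<Longrightarrow> biconnected adj X \<Longrightarrow> 3 \<le> card X \<Longrightarrow>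
      (\<forall>v\<in>X. deg X v \<le> r) \<or> card X \<le> \<delta> \<and> (\<forall>v\<in>X. deg X v = card X - 1) \<or>
      4 \<le> card X \<and> (\<forall>v\<in>X. deg X v = 2)"
begin

abbreviation slope :: real where "slope \<equiv> gallai_slope \<delta>"

lemmas slope_bounds = gallai_slope_bounds[OF d3]

text \<open>Apart from the root, a pendant vertex contributes \<open>1 - c + (c - 2) = -1\<close>
  and any other vertex at most \<open>r - c\<close>. With \<open>t\<close> pendant and
  \<open>u\<close> other vertices the excess is at most \<open>deg X x - t + u * (r - c)\<close>.
  For \<open>u = 0\<close> the root is bounded by \<open>deg_le_others\<close>; for
  \<open>u > 0\<close> the bound \<open>2 * r \<le> \<delta>\<close> enters, and for
  \<open>u = 1\<close> also \<open>1 \<le> t\<close>.\<close>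

lemma excess_sparse:
  assumes X: "X \<subseteq> U" "edge_closed X" "connected_in adj X" "3 \<le> card X" "x \<in> X"
    and le: "\<And>v. v \<in> X \<Longrightarrow> deg X v \<le> r"
  shows "excess slope X x \<le> 0"
proof -
  have fin: "finite X" using X finU finite_subset by blast
  define Q where "Q = X - {x} - pend X x"
  have cX: "card X = 1 + card (pend X x) + card Q"
  proof -
    have "X = insert x (pend X x \<union> Q)" using X by (auto simp: Q_def pend_def)
    then have "card X = card (insert x (pend X x \<union> Q))" by simp
    also have "\<dots> = 1 + card (pend X x \<union> Q)"
      using fin by (subst card_insert_disjoint) (auto simp: Q_def pend_def)
    also have "card (pend X x \<union> Q) = card (pend X x) + card Q"
      using fin by (intro card_Un_disjoint) (auto simp: Q_def pend_def)
    finally show ?thesis by simp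
  qed
  have sX: "(\<Sum>v\<in>X. deg X v) = deg X x + (\<Sum>v\<in>X - {x}. deg X v)"
    using fin X by (simp add: sum.remove)
  have XQ: "X - {x} = pend X x \<union> Q" by (auto simp: Q_def pend_def)
  have "(\<Sum>v\<in>X - {x}. deg X v) = (\<Sum>v\<in>pend X x. deg X v) + (\<Sum>v\<in>Q. deg X v)"
    unfolding XQ using fin by (intro sum.union_disjoint) (auto simp: Q_def pend_def)
  also have "(\<Sum>v\<in>pend X x. deg X v) = card (pend X x)" by (simp add: pend_def)
  also have "(\<Sum>v\<in>Q. deg X v) \<le> card Q * r"
    using sum_bounded_above[of Q "deg X" r] le by (auto simp: Q_def)
  finally have s1: "(\<Sum>v\<in>X - {x}. deg X v) \<le> card (pend X x) + card Q * r" by simp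
  let ?t = "real (card (pend X x))" and ?u = "real (card Q)"
  have ex: "excess slope X x = real (deg X x) + real (\<Sum>v\<in>X - {x}. deg X v) - slope * (?t + ?u) + (slope - 2) * ?t"
    unfolding excess_def sX cX by simp
  have s1': "real (\<Sum>v\<in>X - {x}. deg X v) \<le> ?t + ?u * real r"
    using s1 by (metis of_nat_add of_nat_le_iff of_nat_mult)
  have dr: "real (deg X x) \<le> real r" using le X by simp
  have rd: "2 * real r \<le> real \<delta>" using r2 by linarith
  consider "card Q = 0" | "card Q = 1" | "2 \<le> card Q" by linarith
  then show ?thesis
  proof cases
    case 1
    have "real (deg X x) \<le> real (\<Sum>v\<in>X - {x}. deg X v)"
      using deg_le_others[OF fin, of x] by linarith
    then show ?thesis using s1' 1 unfolding ex by (simp add: algebra_simps)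
  next
    case 2
    then have "1 \<le> ?t" using cX X by simp
    moreover have "real \<delta> \<le> 1 + slope" using slope_bounds by simp
    ultimately show ?thesis using s1' dr rd 2 unfolding ex by (simp add: algebra_simps)
  next
    case 3
    then have u: "2 \<le> ?u" by simp
    have "real r + ?u * real r \<le> 3 / 2 * (?u * real r)"
      using mult_right_mono[OF u of_nat_0_le_iff[of r]] by linarith
    also have "\<dots> \<le> ?u * (3 / 4 * real \<delta>)" using mult_left_mono[OF rd, of ?u] by (simp add: algebra_simps)
    also have "\<dots> \<le> ?u * slope" using slope_bounds u by (intro mult_left_mono) auto
    finally have "real r + ?u * real r \<le> ?u * slope" .
    then show ?thesis using s1' dr unfolding ex by (simp add: algebra_simps)
  qed
qed

text \<open>The charge is calibrated so that a single edge has excess exactly 0. Only a complete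
  graph on \<open>\<delta>\<close> vertices reaches \<open>slope - 2\<close>, and its root has
  degree \<open>\<delta> - 1\<close>, above the threshold.\<close>

lemma excess_block:
  assumes X: "X \<subseteq> U" "edge_closed X" "biconnected adj X" "x \<in> X"
  shows "excess slope X x \<le> (if deg X x + 2 \<le> \<delta> then 0 else slope - 2)"
proof -
  have fin: "finite X" using X finU finite_subset by blast
  have conn: "connected_in adj X" using X by (simp add: biconnected_def)
  have eta: "0 \<le> slope - 2" using slope_bounds by simp
  have cpos: "card X \<noteq> 0" using X fin by auto
  then consider "card X = 1" | "card X = 2" | "3 \<le> card X" by linarith
  then show ?thesis
  proof cases
    case 1
    then have "X = {x}" using X by (metis card_1_singletonE singletonD)
    then have "deg X x = 0" using deg_le_others[OF fin, of x] by simp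
    moreover have "pend X x = {}" using \<open>X = {x}\<close> by (auto simp: pend_def)
    ultimately have "excess slope X x = 0" using \<open>X = {x}\<close> by (simp add: excess_def)
    then show ?thesis using eta by simp
  next
    case 2
    have "card (X - {x}) = 1" using 2 X by simp
    then obtain y where "X - {x} = {y}" by (rule card_1_singletonE)
    then have y: "X = {x, y}" "x \<noteq> y" using X by auto
    have le: "deg X x \<le> 1" "deg X y \<le> 1" using two[OF X(1) 2] y by auto
    have "{x} \<subseteq> X" "x \<in> {x}" "y \<in> X" "y \<notin> {x}" using y by auto
    then obtain a b where "a \<in> {x}" "b \<in> X" "b \<notin> {x}" "adj a b" using connected_inD[OF conn] by metis
    then have "adj x y" using y by auto
    then have "0 < deg X x" "0 < deg X y"
      using deg_pos[OF X(2), of x y] deg_pos[OF X(2), of y x] adj_sym y by auto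
    then have d: "deg X x = 1" "deg X y = 1" using le by linarith+
    have "pend X x = {y}" using y d by (auto simp: pend_def)
    moreover have "(\<Sum>v\<in>X. deg X v) = 2" using y d by (subst y(1)) simp
    ultimately have "excess slope X x = 0" using 2 by (simp add: excess_def)
    then show ?thesis using eta by simp
  next
    case 3
    consider "\<forall>v\<in>X. deg X v \<le> r" | "card X \<le> \<delta>" "\<forall>v\<in>X. deg X v = card X - 1"
      | "4 \<le> card X" "\<forall>v\<in>X. deg X v = 2"
      using blocks[OF X(1-3) 3] by blast
    then show ?thesis
    proof cases
      case 1
      then have "excess slope X x \<le> 0" using excess_sparse[OF X(1,2) conn 3 X(4)] by simp
      then show ?thesis using eta by simp
    next
      case c: 2
      have "pend X x = {}" using c 3 by (auto simp: pend_def)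
      moreover have "(\<Sum>v\<in>X. deg X v) = card X * (card X - 1)" using c by simp
      ultimately have ex: "excess slope X x = (real (card X) - 1) * (real (card X) - slope)"
        using 3 by (simp add: excess_def of_nat_diff algebra_simps)
      show ?thesis
      proof (cases "card X = \<delta>")
        case True
        then have "\<not> deg X x + 2 \<le> \<delta>" using c X 3 by simp
        then show ?thesis using ex True slope_bounds by simp
      next
        case False
        then have "real (card X) \<le> real \<delta> - 1" using c by linarith
        then have "real (card X) - slope \<le> 0" using slope_bounds by linarith
        then have "excess slope X x \<le> 0" unfolding ex using 3 by (intro mult_nonneg_nonpos) auto
        then show ?thesis using eta by simp
      qed
    next
      case c: 3
      have "pend X x = {}" using c by (auto simp: pend_def)
      moreover have "(\<Sum>v\<in>X. deg X v) = card X * 2" using c by simp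
      ultimately have ex: "excess slope X x = real (card X) * 2 - slope * (real (card X) - 1)"
        by (simp add: excess_def)
      have "8 / 3 * (real (card X) - 1) \<le> slope * (real (card X) - 1)"
        using slope_bounds c by (intro mult_right_mono) auto
      \<comment> \<open>Equality holds at 4 vertices; a triangle would fail here but is treated as a
        complete graph.\<close>
      moreover have "real (card X) * 2 \<le> 8 / 3 * (real (card X) - 1)" using c by simp
      ultimately have "excess slope X x \<le> 0" unfolding ex by simp
      then show ?thesis using eta by simp
    qed
  qed
qed

text \<open>A surplus is allowed only if the root has at most one hyperedge left for other parts. At
  a cut vertex \<open>y\<close> other than the root, either \<open>y\<close> has degree 1 on the
  root's side, and the charge lost there pays for the surplus of the other side, or it has degree at
  least 2 there, and the other side has degree at most \<open>\<delta> - 2\<close> at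
  \<open>y\<close> and no surplus.\<close>

lemma excess_bound:
  "X \<subseteq> U \<Longrightarrow> edge_closed X \<Longrightarrow> x \<in> X \<Longrightarrow>
    excess slope X x \<le> (if deg X x + 2 \<le> \<delta> then 0 else slope - 2)"
proof (induction "card X" arbitrary: X x rule: less_induct)
  case less
  note X = less.prems
  have fin: "finite X" using X finU finite_subset by blast
  have eta: "0 \<le> slope - 2" using slope_bounds by simp
  have IH: "excess slope A z \<le> (if deg A z + 2 \<le> \<delta> then 0 else slope - 2)"
    if "A \<subset> X" "edge_closed A" "z \<in> A" for A z
    using less.hyps[of A z] that X fin psubset_card_mono[of X A] by auto
  show ?case
  proof (cases "connected_in adj X")
    case False
    then obtain A0 where A0: "A0 \<subseteq> X" "A0 \<noteq> {}" "A0 \<noteq> X" "\<forall>a\<in>A0. \<forall>b\<in>X - A0. \<not> adj a b"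
      unfolding connected_in_def by blast
    define A where "A = (if x \<in> A0 then A0 else X - A0)"
    define B where "B = X - A"
    have AB: "A \<union> B = X" "B \<union> A = X" "A \<inter> B = {}" "B \<inter> A = {}" "x \<in> A" "B \<noteq> {}" "finite A" "finite B"
      using A0 X fin finite_subset[OF A0(1) fin] by (auto simp: A_def B_def)
    have nadj: "\<forall>a\<in>A - B. \<forall>b\<in>B - A. \<not> adj a b"
      using A0(4) adj_sym unfolding A_def B_def by (auto split: if_splits)
    have nadj': "\<forall>a\<in>B - A. \<forall>b\<in>A - B. \<not> adj a b"
      using nadj adj_sym by blast
    obtain y where y: "y \<in> B" using AB by blast
    have cl: "edge_closed A" "edge_closed B"
      using split_closed[of A B x] split_closed[of B A x] AB X nadj nadj' by auto
    have "deg X x = deg A x + deg B x" using split_deg[of A B x] AB X nadj by simp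
    moreover have "x \<notin> B" using AB by blast
    ultimately have "deg X x = deg A x" using deg_outside[of x B] by simp
    moreover have "A \<subset> X" "B \<subset> X" using AB y by blast+
    then have "excess slope A x \<le> (if deg A x + 2 \<le> \<delta> then 0 else slope - 2)"
      "excess slope B y \<le> (if deg B y + 2 \<le> \<delta> then 0 else slope - 2)"
      using IH cl AB y by blast+
    moreover have "excess slope X x = excess slope A x + excess slope B y - slope +
        (if deg B y = 1 then slope - 2 else 0)"
      using split_excess_disjoint[of A B x y slope] AB X nadj y by simp
    moreover have "deg B y = 1 \<Longrightarrow> deg B y + 2 \<le> \<delta>" using d3 by simp
    ultimately show ?thesis using eta by (auto split: if_splits)
  next
    case conn: True
    show ?thesis
    proof (cases "biconnected adj X")
      case True
      then show ?thesis using excess_block X by blast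
    next
      case False
      then obtain y where y: "y \<in> X" "\<not> connected_in adj (X - {y})"
        using conn by (auto simp: biconnected_def)
      then obtain C where C: "C \<subseteq> X - {y}" "C \<noteq> {}" "C \<noteq> X - {y}"
          "\<forall>a\<in>C. \<forall>b\<in>X - {y} - C. \<not> adj a b"
        unfolding connected_in_def by blast
      define A where "A = (if x \<in> C then insert y C else X - C)"
      define B where "B = (if x \<in> C then X - C else insert y C)"
      have "finite C" using C(1) fin by (meson finite_Diff finite_subset)
      then have AB: "A \<union> B = X" "B \<union> A = X" "A \<inter> B = {y}" "B \<inter> A = {y}" "x \<in> A" "finite A" "finite B"
        using C X y fin by (auto simp: A_def B_def)
      have nonempty: "A - {y} \<noteq> {}" "B - {y} \<noteq> {}"
        using C y by (auto simp: A_def B_def)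
      then have sub: "A \<subset> X" "B \<subset> X" using AB by blast+
      have nadj: "\<forall>a\<in>A - B. \<forall>b\<in>B - A. \<not> adj a b"
        using C(4) adj_sym y(1) unfolding A_def B_def by (auto split: if_splits)
      have nadj': "\<forall>a\<in>B - A. \<forall>b\<in>A - B. \<not> adj a b"
        using nadj adj_sym by blast
      have cl: "edge_closed A" "edge_closed B"
        using split_closed[of A B y] split_closed[of B A y] AB X nadj nadj' by auto
      have yAB: "y \<in> A" "y \<in> B" using AB by auto
      have dy: "deg X v = deg A v + deg B v" for v
        using split_deg[of A B y v] AB X nadj by simp
      have dle: "deg X y \<le> \<delta>" using deg_mono[OF X(1), of y] deg_le[of y] by linarith
      show ?thesis
      proof (cases "x = y")
        case True
        have "excess slope X x = excess slope A x + excess slope B x"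
          using split_excess_root[of A B x slope] AB X nadj True by simp
        moreover have "excess slope A x \<le> (if deg A x + 2 \<le> \<delta> then 0 else slope - 2)"
          "excess slope B x \<le> (if deg B x + 2 \<le> \<delta> then 0 else slope - 2)"
          using IH cl sub yAB True by blast+
        moreover have "deg A x + deg B x \<le> \<delta>" "deg X x = deg A x + deg B x"
          using dle dy True by simp_all
        \<comment> \<open>Two surpluses at the same root would need
          \<open>2 * (\<delta> - 1) \<le> \<delta>\<close>, which fails for
          \<open>\<delta> \<ge> 3\<close>.\<close>
        moreover have "deg A x + 2 \<le> \<delta> \<or> deg B x + 2 \<le> \<delta>"
          using d3 calculation by linarith
        ultimately show ?thesis using eta by (auto split: if_splits)
      next
        case xy: False
        have pos: "0 < deg Z y" if Z: "edge_closed Z" "y \<in> Z" "Z \<subseteq> X" "Z - {y} \<noteq> {}"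
          "\<And>a b. a \<in> Z - {y} \<Longrightarrow> b \<in> X - Z \<Longrightarrow> \<not> adj a b" for Z
        proof -
          obtain z where "z \<in> Z - {y}" using Z by blast
          moreover have "Z - {y} \<subseteq> X" using Z by blast
          ultimately obtain a b where ab: "a \<in> Z - {y}" "b \<in> X" "b \<notin> Z - {y}" "adj a b"
            using connected_inD[OF conn, of "Z - {y}" z y] y by blast
          then have "b = y" using Z(5)[of a b] by blast
          then show ?thesis using deg_pos[OF Z(1), of y a] adj_sym ab Z by blast
        qed
        have "0 < deg A y" by (rule pos) (use cl yAB sub nonempty nadj AB in auto)
        moreover have "0 < deg B y" by (rule pos) (use cl yAB sub nonempty nadj' AB in auto)
        ultimately have p: "0 < deg A y" "0 < deg B y" by auto
        have "excess slope X x = excess slope A x + excess slope B y - (if deg A y = 1 then slope - 2 else 0)"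
          using split_excess[of A B y x slope] AB X nadj xy p by simp
        moreover have "excess slope A x \<le> (if deg A x + 2 \<le> \<delta> then 0 else slope - 2)"
          "excess slope B y \<le> (if deg B y + 2 \<le> \<delta> then 0 else slope - 2)"
          using IH cl sub yAB AB by blast+
        moreover have "x \<notin> B" using AB xy by blast
        then have "deg X x = deg A x" using dy[of x] deg_outside[of x B] by simp
        moreover have "deg A y \<noteq> 1 \<Longrightarrow> deg B y + 2 \<le> \<delta>" using dy[of y] dle p by linarith
        ultimately show ?thesis using eta by (auto split: if_splits)
      qed
    qed
  qed
qed

theorem deg_sum_bound: "real (\<Sum>v\<in>U. deg U v) \<le> slope * real (card U)"
proof (cases "U = {}")
  case False
  then obtain x where x: "x \<in> U" by blast
  have "edge_closed U" using edgeU by (auto simp: edge_closed_def)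
  then have "excess slope U x \<le> slope - 2"
    using excess_bound[OF subset_refl _ x] slope_bounds by (fastforce split: if_splits)
  moreover have "0 \<le> (slope - 2) * real (card (pend U x))" using slope_bounds by simp
  ultimately show ?thesis unfolding excess_def by (simp add: algebra_simps)
qed simp

end

section \<open>Low vertices of critical hypergraphs\<close>

lemma vert_set_induced [simp]: "vert_set (induced_sub H X) = X"
  by (simp add: induced_sub_def)

lemma edge_set_induced: "edge_set (induced_sub H X) = {e \<in> edge_set H. inc H e \<subseteq> X}"
  by (simp add: induced_sub_def)

lemma inc_induced [simp]: "inc (induced_sub H X) = inc H"
  by (simp add: induced_sub_def)

lemma induced_induced: "B \<subseteq> A \<Longrightarrow> induced_sub (induced_sub H A) B = induced_sub H B"
  unfolding induced_sub_def by auto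

lemma del_vert_induced: "del_vert (induced_sub H A) v = induced_sub H (A - {v})"
  unfolding del_vert_def by (simp add: induced_induced)

lemma induced_is_hypergraph: "is_hypergraph H \<Longrightarrow> A \<subseteq> vert_set H \<Longrightarrow> is_hypergraph (induced_sub H A)"
  unfolding is_hypergraph_def by (auto simp: edge_set_induced finite_subset)

lemma prop_deg_le:
  assumes "G \<in> min_forbidden P" "v \<in> vert_set G"
  shows "prop_deg P \<le> hdeg G v"
proof -
  have "prop_deg P \<le> min_hdeg G" unfolding prop_deg_def
    using assms by (intro cINF_lower) auto
  also have "\<dots> \<le> hdeg G v" unfolding min_hdeg_def
    using assms by (intro Min_le) (auto simp: min_forbidden_def is_hypergraph_def)
  finally show ?thesis .
qed

section \<open>Color multiplicities and the sliding move in critical hypergraphs\<close>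

locale critical_hypergraph =
  fixes P :: "('v::infinite, 'e::infinite) hypergraph set" and H :: "('v, 'e) hypergraph"
    and L :: "'v \<Rightarrow> 'c set" and k r :: nat
  assumes P_prop: "hypergraph_property P" and P_smooth: "smooth_property P"
    and P_add: "additive_property P" and P_deg: "prop_deg P = r"
    and r1: "1 \<le> r" and k2: "2 \<le> k" and H: "is_hypergraph H"
    and L: "v \<in> vert_set H \<Longrightarrow> card (L v) = k"
    and crit: "list_critical P L H"
begin

abbreviation V where "V \<equiv> vert_set H"
abbreviation E where "E \<equiv> edge_set H"
abbreviation I where "I \<equiv> inc H"
abbreviation U where "U \<equiv> low_verts P L H"

lemma finV: "finite V" and finE: "finite E" and I_sub: "e \<in> E \<Longrightarrow> I e \<subseteq> V"
  and I_card: "e \<in> E \<Longrightarrow> 2 \<le> card (I e)"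
  using H by (auto simp: is_hypergraph_def)

lemma U_sub: "U \<subseteq> V"
  by (auto simp: low_verts_def)

lemma finU: "finite U"
  using U_sub finV finite_subset by blast

lemma hdeg_U: "v \<in> U \<Longrightarrow> hdeg H v = k * r"
  using L P_deg by (auto simp: low_verts_def)

lemma finL: "v \<in> V \<Longrightarrow> finite (L v)"
  using L k2 by (metis card.infinite not_numeral_le_zero)

lemma I_other:
  assumes "e \<in> E"
  obtains u where "u \<in> I e" "u \<noteq> v"
proof -
  obtain T where "T \<subseteq> I e" "card T = 2" using obtain_subset_with_card_n[OF I_card[OF assms]] by metis
  then show ?thesis using that by (auto simp: card_2_iff)
qed

lemma induced_mono: "induced_sub H A \<in> P \<Longrightarrow> B \<subseteq> A \<Longrightarrow> induced_sub H B \<in> P"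
  using P_smooth induced_induced[of B A H] unfolding smooth_property_def by (metis vert_set_induced)

text \<open>A smallest subset of \<open>Y\<close> inducing a hypergraph outside \<open>P\<close> is
  minimal forbidden, and it contains \<open>v\<close> because all subsets of \<open>Y - {v}\<close>
  induce members of \<open>P\<close>.\<close>

lemma forbidden_degree:
  assumes Y: "Y \<subseteq> V" "induced_sub H Y \<notin> P" and v: "v \<in> Y" "induced_sub H (Y - {v}) \<in> P"
  shows "r \<le> card {e \<in> E. v \<in> I e \<and> I e \<subseteq> Y}"
proof -
  obtain Z where Z: "Z \<subseteq> Y \<and> induced_sub H Z \<notin> P"
      "\<And>Z'. Z' \<subseteq> Y \<and> induced_sub H Z' \<notin> P \<Longrightarrow> card Z \<le> card Z'"
    using ex_has_least_nat[of "\<lambda>Z. Z \<subseteq> Y \<and> induced_sub H Z \<notin> P" Y card] Y by blast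
  have finZ: "finite Z" using Z(1) Y finV by (meson finite_subset)
  have vZ: "v \<in> Z"
  proof (rule ccontr)
    assume "v \<notin> Z"
    then have "Z \<subseteq> Y - {v}" using Z(1) by blast
    then show False using induced_mono[OF v(2)] Z(1) by blast
  qed
  have "induced_sub H (Z - {w}) \<in> P" if w: "w \<in> Z" for w
  proof (rule ccontr)
    assume "\<not> ?thesis"
    then have "card Z \<le> card (Z - {w})" using Z(1) by (intro Z(2)) auto
    then show False using w finZ by (metis card_Diff1_less not_less)
  qed
  then have "induced_sub H Z \<in> min_forbidden P"
    using Z(1) Y induced_is_hypergraph[OF H, of Z] by (auto simp: min_forbidden_def del_vert_induced)
  then have "r \<le> hdeg (induced_sub H Z) v" using prop_deg_le vZ P_deg by fastforce
  also have "\<dots> \<le> card {e \<in> E. v \<in> I e \<and> I e \<subseteq> Y}"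
    unfolding hdeg_def using Z(1) finE by (intro card_mono) (auto simp: edge_set_induced)
  finally show ?thesis .
qed

definition St :: "'v \<Rightarrow> ('v \<Rightarrow> 'c) \<Rightarrow> bool" where
  "St v \<phi> \<longleftrightarrow> is_coloring P L (del_vert H v) \<phi>"

lemma St_iff: "St v \<phi> \<longleftrightarrow> (\<forall>u\<in>V - {v}. \<phi> u \<in> L u) \<and> (\<forall>c. induced_sub H {u \<in> V - {v}. \<phi> u = c} \<in> P)"
proof -
  have "induced_sub (induced_sub H (V - {v})) {u \<in> V - {v}. \<phi> u = c} = induced_sub H {u \<in> V - {v}. \<phi> u = c}" for c
    by (rule induced_induced) auto
  then show ?thesis by (simp add: St_def is_coloring_def del_vert_def)
qed

lemma St_ex: "v \<in> V \<Longrightarrow> \<exists>\<phi>. St v \<phi>"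
  using crit by (simp add: list_critical_def St_def)

definition color_edges :: "'v \<Rightarrow> ('v \<Rightarrow> 'c) \<Rightarrow> 'c \<Rightarrow> 'e set" where
  "color_edges v \<phi> c = {e \<in> E. v \<in> I e \<and> (\<forall>u\<in>I e - {v}. \<phi> u = c)}"

lemma color_edges_disjoint: "c \<noteq> c' \<Longrightarrow> color_edges v \<phi> c \<inter> color_edges v \<phi> c' = {}"
proof (rule ccontr)
  assume c: "c \<noteq> c'" and "color_edges v \<phi> c \<inter> color_edges v \<phi> c' \<noteq> {}"
  then obtain e where e: "e \<in> color_edges v \<phi> c" "e \<in> color_edges v \<phi> c'" by blast
  then obtain u where "u \<in> I e" "u \<noteq> v" using I_other[of e v] by (auto simp: color_edges_def)
  then show False using e c by (auto simp: color_edges_def)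
qed

lemma color_edges_ge:
  assumes v: "v \<in> V" and st: "St v \<phi>" and c: "c \<in> L v"
  shows "r \<le> card (color_edges v \<phi> c)"
proof -
  define Y where "Y = insert v {u \<in> V - {v}. \<phi> u = c}"
  have Yv: "induced_sub H (Y - {v}) \<in> P"
  proof -
    have "Y - {v} = {u \<in> V - {v}. \<phi> u = c}" by (auto simp: Y_def)
    then show ?thesis using st by (simp add: St_iff)
  qed
  have "induced_sub H Y \<notin> P"
  proof
    assume YP: "induced_sub H Y \<in> P"
    have "induced_sub H {u \<in> V. (\<phi>(v := c)) u = c'} \<in> P" for c'
    proof (cases "c' = c")
      case True
      then have "{u \<in> V. (\<phi>(v := c)) u = c'} = Y" using v by (auto simp: Y_def)
      then show ?thesis using YP by simp
    next
      case False
      then have "{u \<in> V. (\<phi>(v := c)) u = c'} = {u \<in> V - {v}. \<phi> u = c'}" by auto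
      then show ?thesis using st by (simp add: St_iff)
    qed
    moreover have "\<forall>u\<in>V. (\<phi>(v := c)) u \<in> L u" using st c by (auto simp: St_iff)
    ultimately have "is_coloring P L H (\<phi>(v := c))" by (simp add: is_coloring_def)
    then show False using crit by (auto simp: list_critical_def)
  qed
  then have "r \<le> card {e \<in> E. v \<in> I e \<and> I e \<subseteq> Y}"
    using forbidden_degree[of Y v] Yv v by (auto simp: Y_def)
  also have "{e \<in> E. v \<in> I e \<and> I e \<subseteq> Y} = color_edges v \<phi> c"
    using I_sub by (auto simp: Y_def color_edges_def)
  finally show ?thesis .
qed

lemma card_Union_color_edges:
  "v \<in> V \<Longrightarrow> card (\<Union>c\<in>L v. color_edges v \<phi> c) = (\<Sum>c\<in>L v. card (color_edges v \<phi> c))"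
  using finL finE color_edges_disjoint by (intro card_UN_disjoint) (auto simp: color_edges_def)

lemma Union_color_edges_sub: "(\<Union>c\<in>L v. color_edges v \<phi> c) \<subseteq> {e \<in> E. v \<in> I e}"
  by (auto simp: color_edges_def)

lemma sum_color_edges_le: "v \<in> V \<Longrightarrow> (\<Sum>c\<in>L v. card (color_edges v \<phi> c)) \<le> hdeg H v"
  unfolding card_Union_color_edges[symmetric] hdeg_def
  using finE Union_color_edges_sub by (intro card_mono) auto

lemma hdeg_ge:
  assumes v: "v \<in> V"
  shows "k * r \<le> hdeg H v"
proof -
  obtain \<phi> where st: "St v \<phi>" using St_ex[OF v] by blast
  have "k * r = (\<Sum>c\<in>L v. r)" using L[OF v] by simp
  also have "\<dots> \<le> (\<Sum>c\<in>L v. card (color_edges v \<phi> c))"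
    using color_edges_ge[OF v st] by (intro sum_mono) auto
  finally show ?thesis using sum_color_edges_le[OF v] by (rule order_trans)
qed

text \<open>The \<open>k\<close> colors of \<open>L v\<close> give disjoint sets of at least
  \<open>r\<close> edges among only \<open>k * r\<close> edges at \<open>v\<close>, so equality
  holds throughout.\<close>

lemma low_color_edges:
  assumes v: "v \<in> U" and st: "St v \<phi>"
  shows "c \<in> L v \<Longrightarrow> card (color_edges v \<phi> c) = r"
    and "(\<Union>c\<in>L v. color_edges v \<phi> c) = {e \<in> E. v \<in> I e}"
proof -
  have vV: "v \<in> V" using v U_sub by blast
  have kr: "(\<Sum>c\<in>L v. r) = k * r" using L[OF vV] by simp
  have "(\<Sum>c\<in>L v. r) \<le> (\<Sum>c\<in>L v. card (color_edges v \<phi> c))"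
    using color_edges_ge[OF vV st] by (intro sum_mono) auto
  then have eq: "(\<Sum>c\<in>L v. r) = (\<Sum>c\<in>L v. card (color_edges v \<phi> c))"
    using sum_color_edges_le[OF vV, of \<phi>] hdeg_U[OF v] kr by linarith
  show "card (color_edges v \<phi> c) = r" if "c \<in> L v"
    using sum_mono_inv[OF eq color_edges_ge[OF vV st] that finL[OF vV]] by simp
  show "(\<Union>c\<in>L v. color_edges v \<phi> c) = {e \<in> E. v \<in> I e}"
    using eq kr hdeg_U[OF v] finE Union_color_edges_sub
    by (intro card_subset_eq) (auto simp: card_Union_color_edges[OF vV] hdeg_def)
qed

lemma low_edge_mono:
  assumes "v \<in> U" "St v \<phi>" "e \<in> E" "v \<in> I e"
  obtains c where "c \<in> L v" "e \<in> color_edges v \<phi> c"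
  using low_color_edges(2)[OF assms(1,2)] assms(3,4) by blast

lemma low_edge_eq:
  assumes "v \<in> U" "St v \<phi>" "e \<in> E" "v \<in> I e" "x \<in> I e" "y \<in> I e" "x \<noteq> v" "y \<noteq> v"
  shows "\<phi> x = \<phi> y"
proof -
  obtain c where "e \<in> color_edges v \<phi> c" using low_edge_mono[OF assms(1-4)] by metis
  then show ?thesis using assms by (auto simp: color_edges_def)
qed

lemma card_color_edges_low:
  assumes "v \<in> U" "St v \<phi>"
  shows "card (color_edges v \<phi> c) = (if c \<in> L v then r else 0)"
proof (cases "c \<in> L v")
  case False
  have "color_edges v \<phi> c = {}"
  proof (rule ccontr)
    assume "color_edges v \<phi> c \<noteq> {}"
    then obtain e where e: "e \<in> color_edges v \<phi> c" by blast
    then obtain c' where "c' \<in> L v" "e \<in> color_edges v \<phi> c'"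
      using low_edge_mono[OF assms, of e] by (auto simp: color_edges_def)
    then show False using e False color_edges_disjoint[of c c' v \<phi>] by blast
  qed
  then show ?thesis using False by simp
qed (use low_color_edges(1)[OF assms] in simp)

text \<open>If the class of \<open>c\<close> with \<open>u\<close> replaced by \<open>v\<close> were
  outside \<open>P\<close>, then \<open>v\<close> would have \<open>r\<close> edges inside it; but
  \<open>v\<close> has only \<open>r\<close> edges of color \<open>c\<close>, and one of them,
  \<open>e\<close>, contains \<open>u\<close>.\<close>

lemma slide:
  assumes v: "v \<in> U" and st: "St v \<phi>" and e: "e \<in> E" "v \<in> I e" "u \<in> I e" "u \<noteq> v"
  shows "St u (\<phi>(v := \<phi> u))"
proof -
  have vV: "v \<in> V" using v U_sub by blast
  obtain c where c: "c \<in> L v" "e \<in> color_edges v \<phi> c" using low_edge_mono[OF v st e(1,2)] by metis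
  have cu: "\<phi> u = c" using c e by (auto simp: color_edges_def)
  define Y where "Y = insert v {w \<in> V - {v, u}. \<phi> w = c}"
  have "induced_sub H Y \<in> P"
  proof (rule ccontr)
    assume nP: "induced_sub H Y \<notin> P"
    have "induced_sub H {w \<in> V - {v}. \<phi> w = c} \<in> P" using st by (simp add: St_iff)
    then have "induced_sub H (Y - {v}) \<in> P" by (rule induced_mono) (auto simp: Y_def)
    then have "r \<le> card {e \<in> E. v \<in> I e \<and> I e \<subseteq> Y}"
      using forbidden_degree[of Y v] nP vV by (auto simp: Y_def)
    also have "{e \<in> E. v \<in> I e \<and> I e \<subseteq> Y} \<subset> color_edges v \<phi> c"
    proof
      show "{e \<in> E. v \<in> I e \<and> I e \<subseteq> Y} \<subseteq> color_edges v \<phi> c"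
        by (auto simp: Y_def color_edges_def)
      have "e \<notin> {e \<in> E. v \<in> I e \<and> I e \<subseteq> Y}" using e by (auto simp: Y_def)
      then show "{e \<in> E. v \<in> I e \<and> I e \<subseteq> Y} \<noteq> color_edges v \<phi> c" using c by blast
    qed
    then have "card {e \<in> E. v \<in> I e \<and> I e \<subseteq> Y} < card (color_edges v \<phi> c)"
      using finE by (intro psubset_card_mono) (auto simp: color_edges_def)
    finally show False using low_color_edges(1)[OF v st c(1)] by simp
  qed
  have "induced_sub H {w \<in> V - {u}. (\<phi>(v := \<phi> u)) w = c'} \<in> P" for c'
  proof (cases "c' = c")
    case True
    then have "{w \<in> V - {u}. (\<phi>(v := \<phi> u)) w = c'} = Y" using vV e cu by (auto simp: Y_def)
    then show ?thesis using \<open>induced_sub H Y \<in> P\<close> by simp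
  next
    case False
    have "induced_sub H {w \<in> V - {v}. \<phi> w = c'} \<in> P" using st by (simp add: St_iff)
    then show ?thesis by (rule induced_mono) (use False cu in auto)
  qed
  moreover have "\<forall>w\<in>V - {u}. (\<phi>(v := \<phi> u)) w \<in> L w" using st c cu by (auto simp: St_iff)
  ultimately show ?thesis by (simp add: St_iff)
qed

section \<open>The shrinking of \<open>H\<close> to its low vertices\<close>

definition low_edges :: "'e set" where "low_edges = {e \<in> E. 2 \<le> card (I e \<inter> U)}"
definition low_inc :: "'e \<Rightarrow> 'v set" where "low_inc e = I e \<inter> U"

sublocale edge_system low_edges low_inc
  by unfold_locales (use finE in \<open>auto simp: low_edges_def low_inc_def\<close>)

lemma low_edgeD: "e \<in> low_edges \<Longrightarrow> e \<in> E"
  by (simp add: low_edges_def)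

lemma low_edge_if_two:
  assumes "e \<in> E" "u \<in> I e" "v \<in> I e" "u \<in> U" "v \<in> U" "u \<noteq> v"
  shows "e \<in> low_edges"
proof -
  have "{u, v} \<subseteq> I e \<inter> U" using assms by auto
  then have "card {u, v} \<le> card (I e \<inter> U)" using finU by (intro card_mono) auto
  then show ?thesis using assms by (simp add: low_edges_def)
qed

lemma deg_le_hdeg: "deg X v \<le> hdeg H v"
  unfolding deg_def hdeg_def using finE
  by (intro card_mono) (auto simp: low_edges_def low_inc_def)

lemma deg_U_le: "deg U v \<le> k * r"
  using deg_le_hdeg[of U v] hdeg_U[of v] deg_outside[of v U] by (cases "v \<in> U") auto

lemma slide_adj: "u \<in> U \<Longrightarrow> v \<in> U \<Longrightarrow> adj v u \<Longrightarrow> St v \<phi> \<Longrightarrow> St u (\<phi>(v := \<phi> u))"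
  using slide[of v \<phi> _ u] by (auto simp: adj_def low_inc_def dest: low_edgeD)

lemma sliding_low:
  assumes "X \<subseteq> U" "biconnected adj X"
  shows "sliding adj St X"
proof
  show "adj v u" if "adj u v" for u v using that by (rule adj_sym)
  show "\<not> adj v v" for v by (simp add: adj_def)
  show "St u (\<phi>(v := \<phi> u))" if "St v \<phi>" "v \<in> X" "u \<in> X" "adj v u" for v \<phi> u
    using slide_adj[of u v \<phi>] that assms(1) by blast
  show "biconnected adj X" by (rule assms(2))
qed

lemma deg_le_if_good:
  assumes X: "X \<subseteq> U" "biconnected adj X" and v: "v \<in> X" "sliding.good adj St X v"
  shows "deg X v \<le> r"
proof -
  interpret sliding adj St X using sliding_low[OF X] .
  have vU: "v \<in> U" using X v by blast
  obtain \<phi> where st: "St v \<phi>" using St_ex vU U_sub by blast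
  have g: "\<phi> u = \<phi> u'" if "u \<in> X" "u' \<in> X" "adj v u" "adj v u'" for u u'
    using v st that unfolding good_def by blast
  let ?D = "{e \<in> low_edges. v \<in> low_inc e \<and> low_inc e \<subseteq> X}"
  have "\<exists>c. ?D \<subseteq> color_edges v \<phi> c"
  proof (cases "\<exists>u\<in>X. adj v u")
    case True
    then obtain u where u: "u \<in> X" "adj v u" by blast
    have "?D \<subseteq> color_edges v \<phi> (\<phi> u)"
    proof
      fix e assume e: "e \<in> ?D"
      then obtain w where w: "w \<in> low_inc e" "w \<noteq> v" using other_in_edge by blast
      then have "w \<in> X" "adj v w" using e by (auto simp: adj_def)
      then have wu: "\<phi> w = \<phi> u" using g u by blast
      have e': "e \<in> E" "v \<in> I e" "w \<in> I e" using e w by (auto simp: low_edges_def low_inc_def)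
      have "\<phi> x = \<phi> u" if "x \<in> I e - {v}" for x
        using low_edge_eq[OF vU st e'(1,2), of x w] that e' w wu by auto
      then show "e \<in> color_edges v \<phi> (\<phi> u)" using e' by (auto simp: color_edges_def)
    qed
    then show ?thesis by blast
  next
    case False
    have "?D = {}"
    proof (rule ccontr)
      assume "?D \<noteq> {}"
      then obtain e where e: "e \<in> ?D" by blast
      then obtain w where w: "w \<in> low_inc e" "w \<noteq> v" using other_in_edge by blast
      then have "w \<in> X" "adj v w" using e by (auto simp: adj_def)
      then show False using False by blast
    qed
    then have "?D \<subseteq> color_edges v \<phi> c" for c by (simp only: empty_subsetI)
    then show ?thesis by blast
  qed
  then obtain c where "?D \<subseteq> color_edges v \<phi> c" by blast
  then have "deg X v \<le> card (color_edges v \<phi> c)"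
    unfolding deg_def using finE by (intro card_mono) (auto simp: color_edges_def)
  then show ?thesis using card_color_edges_low[OF vU st] by (simp split: if_splits)
qed

end

section \<open>Blocks of the low hypergraph\<close>

locale locally_linear_hypergraph = critical_hypergraph +
  assumes simple: "hsimple (shrinking H (low_verts P L H))"
    and not_complete: "\<not> is_complete_graph (k * r + 1) H"
    and d3: "3 \<le> k * r"
begin

lemma low_inc_inj: "inj_on low_inc low_edges"
proof (rule inj_onI)
  fix e e' assume h: "e \<in> low_edges" "e' \<in> low_edges" "low_inc e = low_inc e'"
  have "e \<in> edge_set (shrinking H U)" "e' \<in> edge_set (shrinking H U)"
    "inc (shrinking H U) e = inc (shrinking H U) e'"
    using h by (simp_all add: shrinking_def low_edges_def low_inc_def)
  then show "e = e'" using simple unfolding hsimple_def by blast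
qed

lemma deg_pair_le:
  assumes "card X = 2"
  shows "deg X v \<le> 1"
proof -
  have "low_inc e = X" if "e \<in> low_edges" "low_inc e \<subseteq> X" for e
    using edge2[OF that(1)] that(2) assms by (metis card.infinite card_seteq not_numeral_le_zero zero_neq_numeral)
  then have "e = e'" if "e \<in> {e \<in> low_edges. v \<in> low_inc e \<and> low_inc e \<subseteq> X}"
      "e' \<in> {e \<in> low_edges. v \<in> low_inc e \<and> low_inc e \<subseteq> X}" for e e'
    using that inj_onD[OF low_inc_inj, of e e'] by auto
  then have "card {e \<in> low_edges. v \<in> low_inc e \<and> low_inc e \<subseteq> X} \<le> Suc 0"
    using finES by (subst card_le_Suc0_iff_eq) auto
  then show ?thesis by (simp add: deg_def)
qed

text \<open>Simplicity identifies a two-vertex edge at \<open>v\<close> with its other end. The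
  predicate \<open>Q\<close> is later a color condition, or constantly true to obtain
  degrees.\<close>

lemma card_graph_edges:
  assumes X: "edge_closed X" "v \<in> X" and e2: "\<And>e. e \<in> low_edges \<Longrightarrow> low_inc e \<subseteq> X \<Longrightarrow> card (low_inc e) = 2"
  shows "card {e \<in> low_edges. v \<in> low_inc e \<and> low_inc e \<subseteq> X \<and> (\<forall>u\<in>low_inc e - {v}. Q u)} =
    card {u \<in> X. adj v u \<and> Q u}" (is "card ?L = card ?R")
proof -
  have "low_inc ` ?L = (\<lambda>u. {v, u}) ` ?R"
  proof
    show "low_inc ` ?L \<subseteq> (\<lambda>u. {v, u}) ` ?R"
    proof
      fix S assume "S \<in> low_inc ` ?L"
      then obtain e where e: "e \<in> ?L" "S = low_inc e" by blast
      then obtain u where u: "u \<in> low_inc e" "u \<noteq> v" using other_in_edge by blast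
      have "{v, u} \<subseteq> low_inc e" "card (low_inc e) = 2" using e u e2 by auto
      then have "low_inc e = {v, u}" using u by (metis card_2_iff card_seteq card.infinite order_refl
          zero_neq_numeral)
      moreover have "u \<in> ?R" using e u by (auto simp: adj_def)
      ultimately show "S \<in> (\<lambda>u. {v, u}) ` ?R" using e by blast
    qed
    show "(\<lambda>u. {v, u}) ` ?R \<subseteq> low_inc ` ?L"
    proof
      fix S assume "S \<in> (\<lambda>u. {v, u}) ` ?R"
      then obtain u where u: "u \<in> X" "adj v u" "Q u" "S = {v, u}" by blast
      then obtain e where e: "e \<in> low_edges" "v \<in> low_inc e" "u \<in> low_inc e" "v \<noteq> u"
        by (auto simp: adj_def)
      then have sub: "low_inc e \<subseteq> X" using X u unfolding edge_closed_def by blast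
      then have "card (low_inc e) = 2" using e2 e by blast
      then have "low_inc e = {v, u}" using e by (auto simp: card_2_iff)
      then show "S \<in> low_inc ` ?L" using e u sub by auto
    qed
  qed
  moreover have "inj_on low_inc ?L" using low_inc_inj by (rule inj_on_subset) auto
  moreover have "inj_on (\<lambda>u. {v, u}) ?R" by (auto simp: inj_on_def doubleton_eq_iff)
  ultimately show ?thesis by (metis (no_types, lifting) card_image)
qed

text \<open>The edges of color \<open>c\<close> at \<open>v\<close> number \<open>r\<close> or 0,
  depending on \<open>L v\<close> alone. Those meeting \<open>X\<close> again correspond to
  neighbors of color \<open>c\<close>; the others meet \<open>X\<close> only in \<open>v\<close>, so
  their number depends only on colors outside \<open>X\<close>.\<close>

lemma graph_sliding_low:
  assumes X: "X \<subseteq> U" "edge_closed X" "biconnected adj X"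
    and e2: "\<And>e. e \<in> low_edges \<Longrightarrow> low_inc e \<subseteq> X \<Longrightarrow> card (low_inc e) = 2"
  shows "graph_sliding adj St X"
proof -
  interpret sliding adj St X using sliding_low X by blast
  show ?thesis
  proof unfold_locales
    show "finite X" using X finU finite_subset by blast
    fix v \<phi> \<phi>' and c :: 'c
    assume st: "St v \<phi>" "St v \<phi>'" and v: "v \<in> X" and same: "\<And>u. u \<notin> X \<Longrightarrow> \<phi> u = \<phi>' u"
    have vU: "v \<in> U" using v X by blast
    define Inn where "Inn \<psi> = {e \<in> low_edges. v \<in> low_inc e \<and> low_inc e \<subseteq> X \<and> (\<forall>u\<in>low_inc e - {v}. \<psi> u = c)}" for \<psi>
    define Out where "Out \<psi> = {e \<in> E. v \<in> I e \<and> I e \<inter> X = {v} \<and> (\<forall>u\<in>I e - {v}. \<psi> u = c)}" for \<psi>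
    have dec: "card {u \<in> X. adj v u \<and> \<psi> u = c} + card (Out \<psi>) = (if c \<in> L v then r else 0)"
      if s: "St v \<psi>" for \<psi>
    proof -
      have "color_edges v \<psi> c = Inn \<psi> \<union> Out \<psi>"
      proof (intro equalityI subsetI)
        fix e assume e: "e \<in> color_edges v \<psi> c"
        then have e': "e \<in> E" "v \<in> I e" "\<forall>u\<in>I e - {v}. \<psi> u = c" by (auto simp: color_edges_def)
        show "e \<in> Inn \<psi> \<union> Out \<psi>"
        proof (cases "I e \<inter> X = {v}")
          case True
          then show ?thesis using e' by (auto simp: Out_def)
        next
          case False
          then obtain u where u: "u \<in> I e" "u \<in> X" "u \<noteq> v" using v e' by blast
          then have "e \<in> low_edges" using low_edge_if_two[of e u v] e' X vU by blast
          moreover have "u \<in> low_inc e" "v \<in> low_inc e" using u e' X vU by (auto simp: low_inc_def)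
          ultimately have "low_inc e \<subseteq> X" using X(2) u v unfolding edge_closed_def by blast
          then show ?thesis using \<open>e \<in> low_edges\<close> \<open>v \<in> low_inc e\<close> e' by (auto simp: Inn_def low_inc_def)
        qed
      next
        fix e assume "e \<in> Inn \<psi> \<union> Out \<psi>"
        then show "e \<in> color_edges v \<psi> c"
        proof
          assume "e \<in> Inn \<psi>"
          then have e: "e \<in> low_edges" "v \<in> low_inc e" "\<forall>u\<in>low_inc e - {v}. \<psi> u = c" by (auto simp: Inn_def)
          then obtain u where u: "u \<in> low_inc e" "u \<noteq> v" using other_in_edge by blast
          have e': "e \<in> E" "v \<in> I e" "u \<in> I e" using e u by (auto simp: low_edges_def low_inc_def)
          have "\<psi> x = c" if "x \<in> I e - {v}" for x
            using low_edge_eq[OF vU s e'(1,2), of x u] that e' u e by auto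
          then show ?thesis using e' by (auto simp: color_edges_def)
        qed (auto simp: Out_def color_edges_def)
      qed
      moreover have "Inn \<psi> \<inter> Out \<psi> = {}"
      proof (rule ccontr)
        assume "Inn \<psi> \<inter> Out \<psi> \<noteq> {}"
        then obtain e where e: "e \<in> Inn \<psi>" "e \<in> Out \<psi>" by blast
        then obtain u where "u \<in> low_inc e" "u \<noteq> v" using other_in_edge[of e v] by (auto simp: Inn_def)
        then show False using e by (auto simp: Inn_def Out_def low_inc_def)
      qed
      moreover have "finite (Inn \<psi>)" "finite (Out \<psi>)" using finES finE by (auto simp: Inn_def Out_def)
      ultimately have "card (Inn \<psi>) + card (Out \<psi>) = card (color_edges v \<psi> c)"
        by (simp add: card_Un_disjoint)
      moreover have "card (Inn \<psi>) = card {u \<in> X. adj v u \<and> \<psi> u = c}"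
        unfolding Inn_def by (rule card_graph_edges[OF X(2) v e2])
      ultimately show ?thesis using card_color_edges_low[OF vU s] by simp
    qed
    have "Out \<phi> = Out \<phi>'"
    proof -
      have eq: "\<phi> u = \<phi>' u" if "I e \<inter> X = {v}" "u \<in> I e - {v}" for e u using same that by blast
      show ?thesis unfolding Out_def by (intro Collect_cong conj_cong refl ball_cong) (simp add: eq)
    qed
    then show "card {u \<in> X. adj v u \<and> \<phi> u = c} = card {u \<in> X. adj v u \<and> \<phi>' u = c}"
      using dec[OF st(1)] dec[OF st(2)] by simp
  qed
qed

lemma clique_degree_edges:
  assumes v: "v \<in> X" "X \<subseteq> U" "deg X v = k * r" and e: "e \<in> E" "v \<in> I e"
  shows "e \<in> low_edges \<and> low_inc e \<subseteq> X"
proof -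
  have "{e \<in> low_edges. v \<in> low_inc e \<and> low_inc e \<subseteq> X} = {e \<in> E. v \<in> I e}"
    using v hdeg_U[of v] finE
    by (intro card_subset_eq) (auto simp: deg_def hdeg_def low_inc_def dest: low_edgeD)
  then show ?thesis using e by blast
qed

text \<open>If an edge \<open>e\<close> at \<open>v\<close> contained a high vertex
  \<open>w\<close>, sliding the hole from \<open>v\<close> via any \<open>x\<close> of the clique to
  a second low vertex \<open>u\<close> of \<open>e\<close> would put the color of \<open>x\<close>
  on \<open>v\<close>, where \<open>e\<close> forces it to be the color of \<open>w\<close>. So
  \<open>X - {v}\<close> has one color, although \<open>L v\<close> has \<open>k \<ge> 2\<close>
  colors, each occurring on an edge from \<open>v\<close> into \<open>X\<close>.\<close>

lemma clique_edge_low: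
  assumes X: "X \<subseteq> U" "4 \<le> card X" and d: "\<And>v. v \<in> X \<Longrightarrow> deg X v = k * r"
    and clique: "\<And>u v. u \<in> X \<Longrightarrow> v \<in> X \<Longrightarrow> u \<noteq> v \<Longrightarrow> adj u v"
    and e: "e \<in> E" "v \<in> X" "v \<in> I e"
  shows "I e \<subseteq> U"
proof (rule ccontr)
  assume "\<not> I e \<subseteq> U"
  then obtain w where w: "w \<in> I e" "w \<notin> U" by blast
  have el: "e \<in> low_edges" "low_inc e \<subseteq> X" using clique_degree_edges[of v X e] X d e by auto
  obtain u where u: "u \<in> low_inc e" "u \<noteq> v" using other_in_edge[OF el(1), of v] by blast
  have vX: "v \<in> U" "u \<in> U" "u \<in> X" "u \<in> I e" using e u el X by (auto simp: low_inc_def)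
  have wuv: "w \<noteq> v" "w \<noteq> u" "w \<notin> X" using w vX X by auto
  obtain \<phi> where st: "St v \<phi>" using St_ex vX U_sub by blast
  have wu: "\<phi> u = \<phi> w" using low_edge_eq[OF vX(1) st e(1,3), of u w] vX u w wuv by auto
  have mono: "\<phi> x = \<phi> w" if x: "x \<in> X" "x \<noteq> v" for x
  proof (cases "x = u")
    case False
    have xU: "x \<in> U" using x X by blast
    have "St x (\<phi>(v := \<phi> x))" using slide_adj[OF xU vX(1) clique st] x e(2) by auto
    from slide_adj[OF vX(2) xU clique this] have "St u (\<phi>(v := \<phi> x, x := \<phi> u))"
      using x False vX u by auto
    from low_edge_eq[OF vX(2) this e(1) vX(4) e(3) w(1)]
    have "(\<phi>(v := \<phi> x, x := \<phi> u)) v = (\<phi>(v := \<phi> x, x := \<phi> u)) w"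
      using u wuv by blast
    moreover have "w \<noteq> x" using x wuv by blast
    ultimately show ?thesis using x wuv by simp
  qed (use wu in simp)
  have "card (L v) = k" using L vX U_sub by blast
  then have "\<not> L v \<subseteq> {\<phi> w}" using k2 card_mono[of "{\<phi> w}" "L v"] by fastforce
  then obtain c where c: "c \<in> L v" "c \<noteq> \<phi> w" by blast
  have "card (color_edges v \<phi> c) = r" using low_color_edges(1)[OF vX(1) st c(1)] .
  then obtain e' where e': "e' \<in> color_edges v \<phi> c" using r1 by fastforce
  then have e'': "e' \<in> E" "v \<in> I e'" by (auto simp: color_edges_def)
  have el': "e' \<in> low_edges" "low_inc e' \<subseteq> X" using clique_degree_edges[of v X e'] X d e e'' by auto
  obtain u' where u': "u' \<in> low_inc e'" "u' \<noteq> v" using other_in_edge[OF el'(1), of v] by blast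
  then have "\<phi> u' = c" using e' by (auto simp: color_edges_def low_inc_def)
  moreover have "\<phi> u' = \<phi> w" using mono u' el' by blast
  ultimately show False using c by simp
qed

text \<open>This is connectedness of critical hypergraphs: otherwise a coloring missing only a
  vertex outside \<open>X\<close> and one missing only a vertex of \<open>X\<close> can be glued,
  and additivity puts the combined color classes into \<open>P\<close>.\<close>

lemma separated_part_everything:
  assumes X: "X \<subseteq> V" "X \<noteq> {}" and sep: "\<And>e. e \<in> E \<Longrightarrow> I e \<inter> X \<noteq> {} \<Longrightarrow> I e \<subseteq> X"
  shows "X = V"
proof (rule ccontr)
  assume "X \<noteq> V"
  then obtain w where w: "w \<in> V" "w \<notin> X" using X by blast
  obtain v where v: "v \<in> X" using X by blast
  obtain \<phi>1 where s1: "St w \<phi>1" using St_ex w by blast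
  obtain \<phi>2 where s2: "St v \<phi>2" using St_ex v X by blast
  define \<phi> where "\<phi> u = (if u \<in> X then \<phi>1 u else \<phi>2 u)" for u
  have "induced_sub H {u \<in> V. \<phi> u = c} \<in> P" for c
  proof -
    define A B where "A = {u \<in> X. \<phi>1 u = c}" and "B = {u \<in> V - X. \<phi>2 u = c}"
    have AP: "induced_sub H A \<in> P"
      by (rule induced_mono[of "{u \<in> V - {w}. \<phi>1 u = c}"]) (use s1 w X in \<open>auto simp: St_iff A_def\<close>)
    have BP: "induced_sub H B \<in> P"
      by (rule induced_mono[of "{u \<in> V - {v}. \<phi>2 u = c}"]) (use s2 v in \<open>auto simp: St_iff B_def\<close>)
    have AB: "{u \<in> V. \<phi> u = c} = A \<union> B" using X by (auto simp: A_def B_def \<phi>_def)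
    have disj: "A \<inter> B = {}" by (auto simp: A_def B_def)
    have edisj: "edge_set (induced_sub H A) \<inter> edge_set (induced_sub H B) = {}"
    proof (rule ccontr)
      assume "\<not> ?thesis"
      then obtain e where e: "e \<in> E" "I e \<subseteq> A" "I e \<subseteq> B" by (auto simp: edge_set_induced)
      then obtain z where "z \<in> I e" using I_other by blast
      then show False using e disj by blast
    qed
    have part: "I e \<subseteq> A \<or> I e \<subseteq> B" if e: "e \<in> E" "I e \<subseteq> A \<union> B" for e
    proof (cases "I e \<inter> X = {}")
      case True
      then show ?thesis using e by (auto simp: A_def)
    next
      case False
      then show ?thesis using sep[OF e(1)] e by (auto simp: B_def)
    qed
    have "hunion (induced_sub H A) (induced_sub H B) \<in> P"
      using P_add AP BP disj edisj unfolding additive_property_def by simp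
    moreover have "hiso (hunion (induced_sub H A) (induced_sub H B)) (induced_sub H (A \<union> B))"
      unfolding hiso_def
    proof (intro exI conjI)
      have "edge_set (hunion (induced_sub H A) (induced_sub H B)) = edge_set (induced_sub H (A \<union> B))"
        using part by (auto simp: hunion_def edge_set_induced)
      then show "bij_betw id (edge_set (hunion (induced_sub H A) (induced_sub H B))) (edge_set (induced_sub H (A \<union> B)))"
        by simp
    qed (auto simp: hunion_def)
    moreover have "is_hypergraph (induced_sub H (A \<union> B))"
      using induced_is_hypergraph[OF H, of "A \<union> B"] AB by blast
    ultimately show ?thesis using P_prop AB unfolding hypergraph_property_def by metis
  qed
  moreover have "\<forall>u\<in>V. \<phi> u \<in> L u" using s1 s2 v w by (auto simp: St_iff \<phi>_def)
  ultimately have "is_coloring P L H \<phi>" by (simp add: is_coloring_def)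
  then show False using crit by (auto simp: list_critical_def)
qed

lemma no_large_clique:
  assumes X: "X \<subseteq> U" "edge_closed X" "card X = k * r + 1" and d: "\<And>v. v \<in> X \<Longrightarrow> deg X v = k * r"
    and clique: "\<And>u v. u \<in> X \<Longrightarrow> v \<in> X \<Longrightarrow> u \<noteq> v \<Longrightarrow> adj u v"
    and e2: "\<And>e. e \<in> low_edges \<Longrightarrow> low_inc e \<subseteq> X \<Longrightarrow> card (low_inc e) = 2"
  shows False
proof -
  have c4: "4 \<le> card X" using X(3) d3 by simp
  have le: "e \<in> low_edges \<and> low_inc e \<subseteq> X \<and> I e = low_inc e" if e: "e \<in> E" "I e \<inter> X \<noteq> {}" for e
  proof -
    obtain v where v: "v \<in> X" "v \<in> I e" using e by blast
    have "I e \<subseteq> U" using clique_edge_low[OF X(1) c4 d clique e(1) v] .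
    then show ?thesis using clique_degree_edges[OF v(1) X(1) d[OF v(1)] e(1) v(2)] by (auto simp: low_inc_def)
  qed
  have "X \<noteq> {}" using c4 by auto
  moreover have "I e \<subseteq> X" if "e \<in> E" "I e \<inter> X \<noteq> {}" for e using le[OF that] by metis
  moreover have "X \<subseteq> V" using X(1) U_sub by (rule subset_trans)
  ultimately have XV: "X = V" by (intro separated_part_everything)
  have all: "e \<in> low_edges \<and> low_inc e \<subseteq> X \<and> I e = low_inc e" if e: "e \<in> E" for e
  proof (rule le[OF e])
    obtain z where "z \<in> I e" using I_other[OF e] by blast
    then show "I e \<inter> X \<noteq> {}" using I_sub[OF e] XV by blast
  qed
  have "bij_betw I E {Z. Z \<subseteq> V \<and> card Z = 2}"
  proof (rule bij_betw_imageI)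
    show "inj_on I E" using low_inc_inj all unfolding inj_on_def by metis
    show "I ` E = {Z. Z \<subseteq> V \<and> card Z = 2}"
    proof (intro equalityI subsetI)
      fix Z assume "Z \<in> I ` E"
      then obtain e where "e \<in> E" "Z = I e" by blast
      then show "Z \<in> {Z. Z \<subseteq> V \<and> card Z = 2}" using all e2 XV by auto
    next
      fix Z assume "Z \<in> {Z. Z \<subseteq> V \<and> card Z = 2}"
      then obtain a b where Z: "Z = {a, b}" "a \<noteq> b" "a \<in> X" "b \<in> X" using XV by (auto simp: card_2_iff)
      then obtain e where e: "e \<in> low_edges" "a \<in> low_inc e" "b \<in> low_inc e"
        using clique[of a b] by (auto simp: adj_def)
      then have "card (low_inc e) = 2" using e2 all low_edgeD by blast
      then have "low_inc e = Z" using e Z by (auto simp: card_2_iff)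
      then show "Z \<in> I ` E" using all e low_edgeD by (metis imageI)
    qed
  qed
  then have "is_complete_graph (k * r + 1) H"
    using H X(3) XV by (simp add: is_complete_graph_def)
  then show False using not_complete by simp
qed

lemma low_blocks:
  assumes X: "X \<subseteq> U" "edge_closed X" "biconnected adj X" and c3: "3 \<le> card X"
  shows "(\<forall>v\<in>X. deg X v \<le> r) \<or> card X \<le> k * r \<and> (\<forall>v\<in>X. deg X v = card X - 1) \<or>
     4 \<le> card X \<and> (\<forall>v\<in>X. deg X v = 2)"
proof (cases "\<exists>e\<in>low_edges. low_inc e \<subseteq> X \<and> card (low_inc e) \<noteq> 2")
  case True
  then obtain e where e: "e \<in> low_edges" "low_inc e \<subseteq> X" "card (low_inc e) \<noteq> 2" by blast
  interpret sliding adj St X using sliding_low X by blast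
  have "3 \<le> card (low_inc e)" using edge2[OF e(1)] e(3) by linarith
  then obtain T where T: "T \<subseteq> low_inc e" "card T = 3" using obtain_subset_with_card_n by metis
  then obtain v a b where vab: "T = {v, a, b}" "v \<noteq> a" "a \<noteq> b" "v \<noteq> b" by (auto simp: card_3_iff)
  have "good v"
  proof (rule large_edge_good[of "low_inc e" v a b])
    fix u \<phi> x y assume h: "u \<in> low_inc e" "St u \<phi>" "x \<in> low_inc e - {u}" "y \<in> low_inc e - {u}"
    then have "u \<in> U" "u \<in> I e" "x \<in> I e" "y \<in> I e" by (auto simp: low_inc_def)
    then show "\<phi> x = \<phi> y" using low_edge_eq[of u \<phi> e x y] h low_edgeD[OF e(1)] by auto
  qed (use T vab e in auto)
  then have "\<forall>z\<in>X. good z" using good_all T vab e by blast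
  then show ?thesis using deg_le_if_good X by blast
next
  case False
  then have e2: "card (low_inc e) = 2" if "e \<in> low_edges" "low_inc e \<subseteq> X" for e using that by blast
  interpret graph_sliding adj St X using graph_sliding_low[OF X e2] .
  have dg: "deg X v = card {u \<in> X. adj v u}" if "v \<in> X" for v
    using card_graph_edges[OF X(2) that e2, of "\<lambda>_. True"] by (simp add: deg_def)
  show ?thesis
  proof (cases "\<forall>x\<in>X. \<forall>y\<in>X. x \<noteq> y \<longrightarrow> adj x y")
    case True
    have dc: "deg X v = card X - 1" if v: "v \<in> X" for v
    proof -
      have "{u \<in> X. adj v u} = X - {v}" using True v adj_irrefl by auto
      then show ?thesis using dg[OF v] v by simp
    qed
    have "card X \<le> k * r"
    proof (rule ccontr)
      assume gt: "\<not> card X \<le> k * r"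
      obtain v where v: "v \<in> X" using c3 by fastforce
      have "deg X v \<le> k * r" using deg_mono[OF X(1), of v] deg_U_le[of v] by linarith
      then have "card X = k * r + 1" using dc[OF v] gt c3 by linarith
      then show False using no_large_clique[OF X(1,2)] dc True e2 by simp
    qed
    then show ?thesis using dc by blast
  next
    case False
    then obtain x y where "x \<in> X" "y \<in> X" "x \<noteq> y" "\<not> adj x y" by blast
    then consider "\<forall>v\<in>X. good v" | "4 \<le> card X" "\<forall>v\<in>X. card {u \<in> X. adj v u} = 2"
      using noncomplete_good_or_cycle by blast
    then show ?thesis
    proof cases
      case 1
      then show ?thesis using deg_le_if_good X by blast
    next
      case 2
      then show ?thesis using dg by simp
    qed
  qed
qed

sublocale block_bounds low_edges low_inc U "k * r" r
proof
  show "2 * r \<le> k * r" using k2 by simp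
  show "deg X v \<le> 1" if "card X = 2" for X v using that by (rule deg_pair_le)
qed (use finU d3 deg_U_le low_blocks in \<open>auto simp: low_inc_def\<close>)

section \<open>The final edge count\<close>

lemma high_degree:
  assumes "v \<in> V - U"
  shows "k * r + 1 \<le> hdeg H v"
proof -
  have "hdeg H v \<noteq> k * r" using assms L[of v] P_deg by (auto simp: low_verts_def mult.commute)
  then show ?thesis using hdeg_ge[of v] assms by simp
qed

text \<open>A low vertex \<open>v\<close> is the only low vertex of exactly
  \<open>k * r - deg U v\<close> edges. These edges differ for different \<open>v\<close>, and each
  contains a vertex outside \<open>U\<close>.\<close>

lemma single_edges_bound: "(\<Sum>v\<in>U. k * r - deg U v) \<le> (\<Sum>v\<in>V - U. hdeg H v)"
proof -
  define S where "S v = {e \<in> E. I e \<inter> U = {v}}" for v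
  have "k * r - deg U v = card (S v)" if v: "v \<in> U" for v
  proof -
    let ?D = "{e \<in> low_edges. v \<in> low_inc e \<and> low_inc e \<subseteq> U}"
    have "{e \<in> E. v \<in> I e} = ?D \<union> S v"
    proof (intro equalityI subsetI)
      fix e assume e: "e \<in> {e \<in> E. v \<in> I e}"
      show "e \<in> ?D \<union> S v"
      proof (cases "I e \<inter> U = {v}")
        case False
        then obtain u where "u \<in> I e" "u \<in> U" "u \<noteq> v" using e v by blast
        then have "e \<in> low_edges" using low_edge_if_two[of e u v] e v by blast
        then show ?thesis using e v by (auto simp: low_inc_def)
      qed (use e in \<open>auto simp: S_def\<close>)
    qed (use v in \<open>auto simp: S_def low_inc_def dest: low_edgeD\<close>)
    moreover have "?D \<inter> S v = {}" by (auto simp: S_def low_edges_def)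
    moreover have "finite ?D" "finite (S v)" using finES finE by (auto simp: S_def)
    ultimately have "hdeg H v = deg U v + card (S v)"
      unfolding hdeg_def deg_def by (simp add: card_Un_disjoint)
    then show ?thesis using hdeg_U[OF v] by simp
  qed
  then have "(\<Sum>v\<in>U. k * r - deg U v) = (\<Sum>v\<in>U. card (S v))" by simp
  also have "\<dots> = card (\<Union>v\<in>U. S v)"
    using finU finE by (intro card_UN_disjoint[symmetric]) (auto simp: S_def)
  also have "\<dots> \<le> card (\<Union>v\<in>V - U. {e \<in> E. v \<in> I e})"
  proof (rule card_mono)
    show "(\<Union>v\<in>U. S v) \<subseteq> (\<Union>v\<in>V - U. {e \<in> E. v \<in> I e})"
    proof
      fix e assume "e \<in> (\<Union>v\<in>U. S v)"
      then obtain v where e: "e \<in> E" "I e \<inter> U = {v}" by (auto simp: S_def)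
      then obtain w where "w \<in> I e" "w \<noteq> v" using I_other[of e v] by blast
      then show "e \<in> (\<Union>v\<in>V - U. {e \<in> E. v \<in> I e})" using e I_sub by blast
    qed
  qed (use finV finE in auto)
  also have "\<dots> \<le> (\<Sum>v\<in>V - U. hdeg H v)"
    unfolding hdeg_def using finV by (intro card_UN_le) auto
  finally show ?thesis .
qed

lemma gallai: "gallai_bound (k * r) (card V) \<le> real (hdeg_sum H)"
proof -
  define d where "d = real (k * r)"
  define n u where "n = real (card V)" and "u = real (card U)"
  define W where "W = real (\<Sum>v\<in>V - U. hdeg H v)"
  have d: "3 \<le> d" using d3 unfolding d_def by linarith
  have cVU: "real (card (V - U)) = n - u"
    using card_Diff_subset[OF finU U_sub] card_mono[OF finV U_sub] by (simp add: n_def u_def of_nat_diff)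
  have "hdeg_sum H = (\<Sum>v\<in>V - U. hdeg H v) + (\<Sum>v\<in>U. hdeg H v)"
    unfolding hdeg_sum_def using sum.subset_diff[OF U_sub finV] .
  also have "(\<Sum>v\<in>U. hdeg H v) = card U * (k * r)" using hdeg_U by simp
  finally have S: "real (hdeg_sum H) = W + u * d" by (simp add: W_def u_def d_def)
  have "(\<Sum>v\<in>V - U. k * r + 1) \<le> (\<Sum>v\<in>V - U. hdeg H v)"
    using high_degree by (intro sum_mono) auto
  then have "real (\<Sum>v\<in>V - U. k * r + 1) \<le> W" unfolding W_def by (simp only: of_nat_le_iff)
  then have W1: "(n - u) * (d + 1) \<le> W" using cVU by (simp add: d_def algebra_simps)
  have "real (\<Sum>v\<in>U. k * r - deg U v) = u * d - real (\<Sum>v\<in>U. deg U v)"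
    using deg_U_le by (simp add: of_nat_diff sum_subtractf u_def d_def)
  moreover have "real (\<Sum>v\<in>U. k * r - deg U v) \<le> W"
    unfolding W_def using single_edges_bound by (simp only: of_nat_le_iff)
  moreover have "real (\<Sum>v\<in>U. deg U v) \<le> (d - 1 + 2 / d) * u"
    using deg_sum_bound by (simp add: gallai_slope_def d_def u_def)
  ultimately have W2: "(1 - 2 / d) * u \<le> W" by (simp add: algebra_simps)
  define D where "D = d\<^sup>2 + 2 * d - 2"
  have D: "0 < D" using d by (simp add: D_def power2_eq_square) (smt (verit) mult_pos_pos)
  have W2': "(d - 2) * u \<le> d * W" using W2 d by (simp add: field_simps)
  \<comment> \<open>The weights \<open>(d + 2) * (d - 1)\<close> for \<open>W1\<close> and 1 for
    \<open>W2'\<close> are those for which \<open>u\<close> cancels once \<open>D * (u * d)\<close>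
    is added; together they multiply \<open>W\<close> by \<open>D\<close>, the denominator of the
    bound.\<close>
  have "(d + 2) * (d - 1) * ((n - u) * (d + 1)) + (d - 2) * u
      \<le> (d + 2) * (d - 1) * W + d * W"
    using W1 W2' d by (intro add_mono mult_left_mono) auto
  also have "\<dots> = D * W" by (simp add: D_def power2_eq_square algebra_simps)
  finally have "(d + 2) * (d - 1) * ((n - u) * (d + 1)) + (d - 2) * u \<le> D * W" .
  then have "(d * D + (d - 2)) * n \<le> D * (W + u * d)"
    by (simp add: D_def power2_eq_square algebra_simps)
  then have "d * n + (d - 2) / D * n \<le> W + u * d"
    using D by (simp add: field_simps)
  then show ?thesis unfolding S gallai_bound_def by (simp add: D_def d_def n_def)
qed

end

theorem theorem2p1:
  fixes P :: "('v::infinite, 'e::infinite) hypergraph set"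
    and H :: "('v, 'e) hypergraph"
    and L :: "'v \<Rightarrow> 'c set"
    and k r \<delta> :: nat
  assumes "hypergraph_property P" and "smooth_property P" and "additive_property P"
    and "prop_deg P = r" and "r \<ge> 1"
    and "k \<ge> 2" and "\<delta> = k * r" and "\<delta> \<ge> 3"
    and "is_hypergraph H"
    and "\<forall>v\<in>vert_set H. card (L v) = k"
    and "\<not> is_complete_graph (\<delta> + 1) H"
    and "locally_linear P L H"
  shows "real (hdeg_sum H) \<ge> gallai_bound \<delta> (card (vert_set H))"
proof -
  interpret locally_linear_hypergraph P H L k r
    by unfold_locales (use assms in \<open>auto simp: locally_linear_def\<close>)
  show ?thesis using gallai assms by simp
qed

end
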